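(* The Poisson primitive ideals of $A$ are exactly: the Poisson maximal ideals of $A$, and the proper Poisson ideals of $A$ that are minimal prime ideals of some proper ideal $f^1_{\lambda_1,\mu_1}A+\dots+f^{n-2}_{\lambda_{n-2},\mu_{n-2}}A$ with $(\lambda_i,\mu_i)\in\mathbb{C}^2\setminus\{(0,0)\}$ for all $i$. Moreover $A$ satisfies the Poisson Dixmier–Moeglin equivalence: for a Poisson prime ideal $P$ of $A$, the conditions "$P$ is locally closed", "$P$ is Poisson primitive" and "$P$ is rational" are equivalent.
   Context: Let $n\ge 3$, $A=\mathbb{C}[x_1,\dots,x_n]$. Fix $s_1,t_1,\dots,s_{n-2},t_{n-2}\in A$ with each $t_i\ne 0$ and $s_i,t_i$ coprime, such that $s_1/t_1,\dots,s_{n-2}/t_{n-2}$ are algebraically independent over $\mathbb{C}$. $A$ carries the Poisson bracket $\{f,g\}=(t_1\cdots t_{n-2})^2\,\mathrm{Jac}(f,g,s_1/t_1,\dots,s_{n-2}/t_{n-2})$ ($\mathrm{Jac}$ = Jacobian determinant with respect to $x_1,\dots,x_n$). For $(\lambda_i,\mu_i)\in\mathbb{C}^2\setminus\{(0,0)\}$, $f^i_{\lambda_i,\mu_i}=\lambda_is_i-\mu_it_i$. A Poisson ideal is an ideal $I$ with $\{I,A\}\subseteq I$; a Poisson prime (resp. Poisson maximal) ideal is a prime (resp. maximal) ideal that is Poisson. A Poisson ideal $I$ is residually null if the induced bracket on $A/I$ is zero, and proper otherwise. The Poisson core $\mathcal{P}(J)$ of an ideal $J$ is the largest Poisson ideal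 contained in $J$; a Poisson ideal is Poisson primitive if it equals $\mathcal{P}(M)$ for a maximal ideal $M$. A Poisson prime $P$ is locally closed if the intersection of all Poisson primes strictly containing $P$ strictly contains $P$, and rational if the Poisson centre $\{z\in Q(A/P):\{z,r\}=0\ \forall r\}$ of the fraction field $Q(A/P)$ (with the induced bracket) equals $\mathbb{C}$. *)

theory Defs
  imports Complex_Main "HOL-Library.Poly_Mapping" "HOL-Combinatorics.Permutations"
          "HOL-Computational_Algebra.Fraction_Field"
begin

text \<open>Multivariate polynomials over the complex numbers: a polynomial is a finitely
supported map from monomials (exponent vectors nat =>0 nat) to coefficients.
The ring A = C[x_0,...,x_(n-1)] is the subset of polynomials using only the
variables with index < n (a subring of the big polynomial ring).\<close>

type_synonym mpoly = "(nat \<Rightarrow>\<^sub>0 nat) \<Rightarrow>\<^sub>0 complex"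

definition Apoly :: "nat \<Rightarrow> mpoly set" where
  "Apoly n = {p. \<forall>m \<in> Poly_Mapping.keys p. Poly_Mapping.keys m \<subseteq> {..<n}}"

definition const :: "complex \<Rightarrow> mpoly" where
  "const c = Poly_Mapping.single 0 c"

definition dvdA :: "nat \<Rightarrow> mpoly \<Rightarrow> mpoly \<Rightarrow> bool" where
  "dvdA n c a \<longleftrightarrow> (\<exists>k\<in>Apoly n. a = c * k)"

definition coprimeA :: "nat \<Rightarrow> mpoly \<Rightarrow> mpoly \<Rightarrow> bool" where
  "coprimeA n a b \<longleftrightarrow> (\<forall>c\<in>Apoly n. dvdA n c a \<and> dvdA n c b \<longrightarrow> dvdA n c 1)"

definition pd :: "nat \<Rightarrow> mpoly \<Rightarrow> mpoly" where
  "pd i p = Abs_poly_mapping (\<lambda>m. of_nat (Poly_Mapping.lookup (m :: nat \<Rightarrow>\<^sub>0 nat) i + 1) * Poly_Mapping.lookup p (m + Poly_Mapping.single i (1::nat)))"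

definition detn :: "nat \<Rightarrow> (nat \<Rightarrow> nat \<Rightarrow> 'a::comm_ring_1) \<Rightarrow> 'a" where
  "detn n M = (\<Sum>\<sigma> | \<sigma> permutes {..<n}. of_int (sign \<sigma>) * (\<Prod>i<n. M i (\<sigma> i)))"

text \<open>The Poisson bracket {f,g} = (t_1...t_(n-2))^2 Jac(f,g,s_1/t_1,...,s_(n-2)/t_(n-2)).
By multilinearity of the determinant, multiplying the row of s_i/t_i, whose entries
are (t_i d_j s_i - s_i d_j t_i)/t_i^2, by t_i^2 gives the polynomial matrix below.
The families are indexed from 0: s 0, ..., s (n-3).\<close>
definition pb :: "nat \<Rightarrow> (nat \<Rightarrow> mpoly) \<Rightarrow> (nat \<Rightarrow> mpoly) \<Rightarrow> mpoly \<Rightarrow> mpoly \<Rightarrow> mpoly" where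
  "pb n s t f g = detn n (\<lambda>r j. if r = 0 then pd j f else if r = 1 then pd j g
       else t (r - 2) * pd j (s (r - 2)) - s (r - 2) * pd j (t (r - 2)))"

definition frac_eval :: "mpoly \<Rightarrow> (nat \<Rightarrow> mpoly) \<Rightarrow> (nat \<Rightarrow> mpoly) \<Rightarrow> mpoly fract" where
  "frac_eval F s t = (\<Sum>m :: nat \<Rightarrow>\<^sub>0 nat \<in> Poly_Mapping.keys F.
      Fract (const (Poly_Mapping.lookup F m)) 1 *
      (\<Prod>i \<in> Poly_Mapping.keys m. Fract (s i) (t i) ^ Poly_Mapping.lookup m i))"

definition alg_indep :: "nat \<Rightarrow> (nat \<Rightarrow> mpoly) \<Rightarrow> (nat \<Rightarrow> mpoly) \<Rightarrow> bool" where
  "alg_indep k s t \<longleftrightarrow> (\<forall>F \<in> Apoly k. F \<noteq> 0 \<longrightarrow> frac_eval F s t \<noteq> 0)"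

definition is_ideal :: "nat \<Rightarrow> mpoly set \<Rightarrow> bool" where
  "is_ideal n I \<longleftrightarrow> I \<subseteq> Apoly n \<and> 0 \<in> I \<and> (\<forall>a\<in>I. \<forall>b\<in>I. a + b \<in> I)
     \<and> (\<forall>a\<in>I. \<forall>r\<in>Apoly n. r * a \<in> I)"

definition is_prime_ideal :: "nat \<Rightarrow> mpoly set \<Rightarrow> bool" where
  "is_prime_ideal n P \<longleftrightarrow> is_ideal n P \<and> P \<noteq> Apoly n
     \<and> (\<forall>a\<in>Apoly n. \<forall>b\<in>Apoly n. a * b \<in> P \<longrightarrow> a \<in> P \<or> b \<in> P)"

definition is_maximal_ideal :: "nat \<Rightarrow> mpoly set \<Rightarrow> bool" where
  "is_maximal_ideal n M \<longleftrightarrow> is_ideal n M \<and> M \<noteq> Apoly n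
     \<and> (\<forall>I. is_ideal n I \<and> M \<subseteq> I \<longrightarrow> I = M \<or> I = Apoly n)"

definition is_minimal_prime_over :: "nat \<Rightarrow> mpoly set \<Rightarrow> mpoly set \<Rightarrow> bool" where
  "is_minimal_prime_over n J P \<longleftrightarrow> is_prime_ideal n P \<and> J \<subseteq> P
     \<and> (\<forall>Q. is_prime_ideal n Q \<and> J \<subseteq> Q \<and> Q \<subseteq> P \<longrightarrow> Q = P)"

definition gen_ideal :: "nat \<Rightarrow> nat \<Rightarrow> (nat \<Rightarrow> mpoly) \<Rightarrow> mpoly set" where
  "gen_ideal n k g = {\<Sum>i<k. r i * g i | r. \<forall>i<k. r i \<in> Apoly n}"

definition is_poisson_ideal :: "nat \<Rightarrow> (nat \<Rightarrow> mpoly) \<Rightarrow> (nat \<Rightarrow> mpoly) \<Rightarrow> mpoly set \<Rightarrow> bool" where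
  "is_poisson_ideal n s t I \<longleftrightarrow> is_ideal n I \<and> (\<forall>a\<in>I. \<forall>b\<in>Apoly n. pb n s t a b \<in> I)"

definition residually_null :: "nat \<Rightarrow> (nat \<Rightarrow> mpoly) \<Rightarrow> (nat \<Rightarrow> mpoly) \<Rightarrow> mpoly set \<Rightarrow> bool" where
  "residually_null n s t I \<longleftrightarrow> (\<forall>a\<in>Apoly n. \<forall>b\<in>Apoly n. pb n s t a b \<in> I)"

definition is_proper_poisson_ideal :: "nat \<Rightarrow> (nat \<Rightarrow> mpoly) \<Rightarrow> (nat \<Rightarrow> mpoly) \<Rightarrow> mpoly set \<Rightarrow> bool" where
  "is_proper_poisson_ideal n s t I \<longleftrightarrow> is_poisson_ideal n s t I \<and> \<not> residually_null n s t I"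

definition is_poisson_prime :: "nat \<Rightarrow> (nat \<Rightarrow> mpoly) \<Rightarrow> (nat \<Rightarrow> mpoly) \<Rightarrow> mpoly set \<Rightarrow> bool" where
  "is_poisson_prime n s t P \<longleftrightarrow> is_poisson_ideal n s t P \<and> is_prime_ideal n P"

definition is_poisson_maximal :: "nat \<Rightarrow> (nat \<Rightarrow> mpoly) \<Rightarrow> (nat \<Rightarrow> mpoly) \<Rightarrow> mpoly set \<Rightarrow> bool" where
  "is_poisson_maximal n s t M \<longleftrightarrow> is_poisson_ideal n s t M \<and> is_maximal_ideal n M"

definition poisson_core :: "nat \<Rightarrow> (nat \<Rightarrow> mpoly) \<Rightarrow> (nat \<Rightarrow> mpoly) \<Rightarrow> mpoly set \<Rightarrow> mpoly set" where
  "poisson_core n s t J = (THE I. is_poisson_ideal n s t I \<and> I \<subseteq> J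
      \<and> (\<forall>I'. is_poisson_ideal n s t I' \<and> I' \<subseteq> J \<longrightarrow> I' \<subseteq> I))"

definition is_poisson_primitive :: "nat \<Rightarrow> (nat \<Rightarrow> mpoly) \<Rightarrow> (nat \<Rightarrow> mpoly) \<Rightarrow> mpoly set \<Rightarrow> bool" where
  "is_poisson_primitive n s t P \<longleftrightarrow> (\<exists>M. is_maximal_ideal n M \<and> P = poisson_core n s t M)"

definition locally_closed :: "nat \<Rightarrow> (nat \<Rightarrow> mpoly) \<Rightarrow> (nat \<Rightarrow> mpoly) \<Rightarrow> mpoly set \<Rightarrow> bool" where
  "locally_closed n s t P \<longleftrightarrow> P \<subset> \<Inter> {Q. is_poisson_prime n s t Q \<and> P \<subset> Q}"

text \<open>Rationality. Elements of Q(A/P) are fractions a/b with a, b in A, b not in P;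
a/b = c/d iff a d - b c is in P. The induced bracket is
{a/b, c/d} = ({a,c} b d - {a,d} b c - {b,c} a d + {b,d} a c) / (b^2 d^2),
so a/b is Poisson central iff that numerator lies in P for all c/d. The Poisson
centre equals C iff every central a/b equals (the image of) some constant k,
i.e. a - k b is in P.\<close>
definition frac_bracket_num :: "nat \<Rightarrow> (nat \<Rightarrow> mpoly) \<Rightarrow> (nat \<Rightarrow> mpoly) \<Rightarrow> mpoly \<Rightarrow> mpoly \<Rightarrow> mpoly \<Rightarrow> mpoly \<Rightarrow> mpoly" where
  "frac_bracket_num n s t a b c d =
     pb n s t a c * b * d - pb n s t a d * b * c - pb n s t b c * a * d + pb n s t b d * a * c"

definition poisson_central_frac :: "nat \<Rightarrow> (nat \<Rightarrow> mpoly) \<Rightarrow> (nat \<Rightarrow> mpoly) \<Rightarrow> mpoly set \<Rightarrow> mpoly \<Rightarrow> mpoly \<Rightarrow> bool" where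
  "poisson_central_frac n s t P a b \<longleftrightarrow>
     (\<forall>c\<in>Apoly n. \<forall>d\<in>Apoly n. d \<notin> P \<longrightarrow> frac_bracket_num n s t a b c d \<in> P)"

definition poisson_rational :: "nat \<Rightarrow> (nat \<Rightarrow> mpoly) \<Rightarrow> (nat \<Rightarrow> mpoly) \<Rightarrow> mpoly set \<Rightarrow> bool" where
  "poisson_rational n s t P \<longleftrightarrow>
     (\<forall>a\<in>Apoly n. \<forall>b\<in>Apoly n. b \<notin> P \<longrightarrow> poisson_central_frac n s t P a b
        \<longrightarrow> (\<exists>k. a - const k * b \<in> P))"

end

theory Submission
  imports Defs "Jordan_Normal_Form.Determinant" "HOL-Computational_Algebra.Fundamental_Theorem_Algebra"
    "HOL-Analysis.Continuum_Not_Denumerable"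
begin

text \<open>A rational Poisson prime P contains some f i = la i * s i - mu i * t i for every i, because
  s i / t i is a Casimir. If P is residually null, rationality makes it a maximal ideal. Otherwise
  P is the only prime between the ideal of the f i and P: replacing a smaller prime by its Poisson core
  Q, look at a point M of P where some {a, b} does not vanish. The f i, a, b are local coordinates
  there, and P, being stable under the two Hamiltonian vector fields of a and b, lies in Q + M^k
  for every k, hence in Q by Krull's intersection theorem. The same uniqueness shows that every Poisson
  prime strictly above P is residually null, so P is locally closed. That locally closed
  primes are primitive and primitive ones rational is formal, given that Poisson cores of primes
  are prime and that the residue field at a maximal ideal is the field of complex numbers.\<close>

section \<open>The polynomial ring and partial derivatives\<close>

text \<open>A height count for primes over n - 2 generators would be the usual route to the
  uniqueness of P. Here its place is taken by the order of vanishing at a single point. An Euler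
  derivation multiplies terms of order k by k times a unit, and k is invertible in \<complex> for k
  > 0; so an element whose image gains one order must gain it itself. Krull's theorem turns infinite
  order into membership up to a factor 1 - m, and primeness removes that factor. The obstacle is
  that both primes in this comparison must be Poisson and contain every \<open>f i\<close>. The
  Casimir identity shows that \<open>f i\<close> divides u {f i, g} for u = s i and u = t i, but not
  at once that it divides {f i, g}. Saturating by whichever u lies outside the smaller prime bridges
  this and keeps \<open>f i\<close> in its Poisson core. The uncountability of \<complex> serves
  twice in one argument: it identifies the residue fields, and it provides points of a prime at
  which a given element outside the prime does not vanish.\<close>

definition var :: "nat \<Rightarrow> mpoly" where
  "var i = Poly_Mapping.single (Poly_Mapping.single i 1) 1"

lemma Apoly_zero [simp]: "0 \<in> Apoly n"
  by (simp add: Apoly_def)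

lemma Apoly_const [simp]: "const c \<in> Apoly n"
  by (simp add: Apoly_def const_def)

lemma Apoly_one [simp]: "1 \<in> Apoly n"
  by (simp add: Apoly_def)

lemma Apoly_var [simp]: "i < n \<Longrightarrow> var i \<in> Apoly n"
  by (simp add: Apoly_def var_def)

lemma Apoly_add [simp]: "a \<in> Apoly n \<Longrightarrow> b \<in> Apoly n \<Longrightarrow> a + b \<in> Apoly n"
  unfolding Apoly_def using Poly_Mapping.keys_add by fastforce

lemma Apoly_uminus [simp]: "a \<in> Apoly n \<Longrightarrow> - a \<in> Apoly n"
  unfolding Apoly_def by (simp add: in_keys_iff)

lemma Apoly_diff [simp]: "a \<in> Apoly n \<Longrightarrow> b \<in> Apoly n \<Longrightarrow> a - b \<in> Apoly n"
  using Apoly_add[of a n "- b"] by simp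

lemma Apoly_mult [simp]: "a \<in> Apoly n \<Longrightarrow> b \<in> Apoly n \<Longrightarrow> a * b \<in> Apoly n"
  unfolding Apoly_def
proof (clarsimp)
  fix m x
  assume ab: "\<forall>m\<in>Poly_Mapping.keys a. Poly_Mapping.keys m \<subseteq> {..<n}"
    "\<forall>m\<in>Poly_Mapping.keys b. Poly_Mapping.keys m \<subseteq> {..<n}"
    and m: "m \<in> Poly_Mapping.keys (a * b)" and x: "x \<in> Poly_Mapping.keys m"
  obtain k l where "m = k + l" "k \<in> Poly_Mapping.keys a" "l \<in> Poly_Mapping.keys b"
    using m keys_mult[of a b] by blast
  then show "x < n"
    using ab x Poly_Mapping.keys_add[of k l] by fastforce
qed

lemma Apoly_sum [simp]: "(\<And>i. i \<in> S \<Longrightarrow> f i \<in> Apoly n) \<Longrightarrow> sum f S \<in> Apoly n"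
  by (induction S rule: infinite_finite_induct) auto

lemma Apoly_prod [simp]: "(\<And>i. i \<in> S \<Longrightarrow> f i \<in> Apoly n) \<Longrightarrow> prod f S \<in> Apoly n"
  by (induction S rule: infinite_finite_induct) auto

lemma Apoly_power [simp]: "a \<in> Apoly n \<Longrightarrow> a ^ k \<in> Apoly n"
  by (induction k) auto

lemma Apoly_of_nat [simp]: "of_nat k \<in> Apoly n"
  by (induction k) auto

lemma Apoly_of_int [simp]: "of_int k \<in> Apoly n"
  by (cases k) (auto simp del: of_nat_Suc)

lemma const_0 [simp]: "const 0 = 0"
  by (simp add: const_def)

lemma const_1 [simp]: "const 1 = 1"
  by (simp add: const_def)

lemma const_add: "const (c + d) = const c + const d"
  by (simp add: const_def single_add)

lemma const_uminus: "const (- c) = - const c"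
  by (simp add: const_def single_uminus)

lemma const_mult: "const (c * d) = const c * const d"
  by (simp add: const_def mult_single)

lemma const_of_nat: "const (of_nat k) = of_nat k"
  by (simp add: const_def)

lemma const_inverse_mult: "c \<noteq> 0 \<Longrightarrow> const (inverse c) * (const c * a) = a"
  by (simp add: const_mult[symmetric] mult.assoc[symmetric])

lemma mpoly_eq_sum_single:
  "(p::mpoly) = (\<Sum>m\<in>Poly_Mapping.keys p. Poly_Mapping.single m (Poly_Mapping.lookup p m))"
  by (rule poly_mapping_eqI)
    (simp add: lookup_sum lookup_single when_def sum.delta in_keys_iff)

lemma single_monomial_induct:
  assumes "Poly_Mapping.keys m \<subseteq> S"
    and const: "\<And>c. P (const c)"
    and var: "\<And>i p. i \<in> S \<Longrightarrow> P p \<Longrightarrow> P (var i * p)"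
  shows "P (Poly_Mapping.single m c)"
  using assms(1)
proof (induction "\<Sum>i\<in>Poly_Mapping.keys m. Poly_Mapping.lookup m i" arbitrary: m rule: less_induct)
  case less
  show ?case
  proof (cases "m = 0")
    case True
    then show ?thesis using const[of c] by (simp add: const_def)
  next
    case False
    then obtain i where i: "i \<in> Poly_Mapping.keys m"
      by (metis all_not_in_conv keys_eq_empty)
    define m' where "m' = m - Poly_Mapping.single i 1"
    have look: "Poly_Mapping.lookup m' j = Poly_Mapping.lookup m j - (if j = i then 1 else 0)" for j
      by (simp add: m'_def lookup_minus lookup_single when_def)
    have m: "m = Poly_Mapping.single i 1 + m'"
      using i by (intro poly_mapping_eqI) (auto simp: lookup_add look lookup_single when_def in_keys_iff)
    have sub: "Poly_Mapping.keys m' \<subseteq> Poly_Mapping.keys m"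
      by (auto simp: in_keys_iff look)
    have "(\<Sum>i\<in>Poly_Mapping.keys m'. Poly_Mapping.lookup m' i)
        = (\<Sum>i\<in>Poly_Mapping.keys m. Poly_Mapping.lookup m' i)"
      by (rule sum.mono_neutral_left) (use sub in \<open>auto simp: in_keys_iff\<close>)
    also have "\<dots> < (\<Sum>i\<in>Poly_Mapping.keys m. Poly_Mapping.lookup m i)"
      by (rule sum_strict_mono_ex1) (use i in \<open>auto simp: look in_keys_iff intro!: bexI[of _ i]\<close>)
    finally have "P (Poly_Mapping.single m' c)"
      using less sub by blast
    then have "P (var i * Poly_Mapping.single m' c)"
      using var i less.prems by blast
    then show ?thesis
      by (subst m) (simp add: var_def mult_single)
  qed
qed

lemma Apoly_induct [consumes 1, case_names const var add mult]:
  assumes p: "p \<in> Apoly n"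
    and const: "\<And>c. P (const c)"
    and var: "\<And>i. i < n \<Longrightarrow> P (var i)"
    and add: "\<And>a b. a \<in> Apoly n \<Longrightarrow> b \<in> Apoly n \<Longrightarrow> P a \<Longrightarrow> P b \<Longrightarrow> P (a + b)"
    and mult: "\<And>a b. a \<in> Apoly n \<Longrightarrow> b \<in> Apoly n \<Longrightarrow> P a \<Longrightarrow> P b \<Longrightarrow> P (a * b)"
  shows "P p"
proof -
  have mono: "Poly_Mapping.single m c \<in> Apoly n \<and> P (Poly_Mapping.single m c)"
    if "Poly_Mapping.keys m \<subseteq> {..<n}" for m c
    using that by (rule single_monomial_induct) (use const var mult in auto)
  have "(\<Sum>m\<in>S. Poly_Mapping.single m (Poly_Mapping.lookup p m)) \<in> Apoly n
      \<and> P (\<Sum>m\<in>S. Poly_Mapping.single m (Poly_Mapping.lookup p m))"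
    if "finite S" "S \<subseteq> Poly_Mapping.keys p" for S
    using that
  proof (induction S rule: finite_induct)
    case empty
    then show ?case using const[of 0] by simp
  next
    case (insert m S)
    then have "Poly_Mapping.keys m \<subseteq> {..<n}"
      using p by (auto simp: Apoly_def)
    with insert mono[of m] add show ?case by simp
  qed
  from this[of "Poly_Mapping.keys p"] show ?thesis
    by (subst mpoly_eq_sum_single) auto
qed

text \<open>\<open>pd\<close> is defined through \<open>Abs_poly_mapping\<close>, so its
  coefficients can be read off only once the support is known to be finite. It lies in the preimage
  of the keys of \<open>p\<close> under an injective shift.\<close>

lemma lookup_pd:
  "Poly_Mapping.lookup (pd i p) m
    = of_nat (Poly_Mapping.lookup m i + 1) * Poly_Mapping.lookup p (m + Poly_Mapping.single i 1)"
proof -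
  have "finite ((\<lambda>m. m + Poly_Mapping.single i 1) -` Poly_Mapping.keys p)"
    by (rule finite_vimageI) (auto simp: inj_on_def)
  then have "finite {m. of_nat (Poly_Mapping.lookup m i + 1)
      * Poly_Mapping.lookup p (m + Poly_Mapping.single i 1) \<noteq> 0}"
    by (rule rev_finite_subset) (auto simp: in_keys_iff)
  then show ?thesis
    by (simp add: pd_def)
qed

lemma pd_add: "pd i (p + q) = pd i p + pd i q"
  by (rule poly_mapping_eqI) (simp add: lookup_pd lookup_add algebra_simps)

lemma pd_0 [simp]: "pd i 0 = 0"
  by (rule poly_mapping_eqI) (simp add: lookup_pd)

lemma pd_uminus: "pd i (- p) = - pd i p"
  by (rule poly_mapping_eqI) (simp add: lookup_pd)

lemma pd_diff: "pd i (p - q) = pd i p - pd i q"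
  using pd_add[of i p "- q"] by (simp add: pd_uminus)

lemma pd_sum: "pd i (sum f S) = (\<Sum>x\<in>S. pd i (f x))"
  by (induction S rule: infinite_finite_induct) (simp_all add: pd_add)

text \<open>Subtraction of exponents is truncated: if \<open>i\<close> does not occur in
  \<open>m\<close>, the exponent on the right is \<open>m\<close> itself, but the coefficient is
  then 0.\<close>

lemma pd_single:
  "pd i (Poly_Mapping.single m c)
    = Poly_Mapping.single (m - Poly_Mapping.single i 1) (of_nat (Poly_Mapping.lookup m i) * c)"
proof (rule poly_mapping_eqI)
  fix k
  have "of_nat (Poly_Mapping.lookup k i + 1) * c = of_nat (Poly_Mapping.lookup m i) * c"
    if "k + Poly_Mapping.single i 1 = m"
    by (simp add: that[symmetric] lookup_add)
  moreover have "k + Poly_Mapping.single i 1 = m"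
    if "k = m - Poly_Mapping.single i 1" "Poly_Mapping.lookup m i \<noteq> 0"
    unfolding that(1) using that(2)
    by (intro poly_mapping_eqI) (auto simp: lookup_add lookup_minus lookup_single when_def)
  moreover have "k = m - Poly_Mapping.single i 1" if "k + Poly_Mapping.single i 1 = m"
    using that by auto
  ultimately show "Poly_Mapping.lookup (pd i (Poly_Mapping.single m c)) k
    = Poly_Mapping.lookup (Poly_Mapping.single (m - Poly_Mapping.single i 1)
        (of_nat (Poly_Mapping.lookup m i) * c)) k"
    unfolding lookup_pd lookup_single when_def by (cases "Poly_Mapping.lookup m i = 0") auto
qed

lemma pd_mult: "pd i (p * q) = pd i p * q + p * pd i q"
proof -
  let ?S = "Poly_Mapping.single :: (nat \<Rightarrow>\<^sub>0 nat) \<Rightarrow> complex \<Rightarrow> mpoly"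
  \<comment> \<open>Truncated subtraction commutes with adding \<open>k\<close> unless
    \<open>i\<close> is absent from \<open>m\<close>, and in that case the coefficient makes both
    sides 0.\<close>
  have move: "?S (m - Poly_Mapping.single i 1) (of_nat (Poly_Mapping.lookup m i) * c) * ?S k d
      = ?S (m + k - Poly_Mapping.single i 1) (of_nat (Poly_Mapping.lookup m i) * c * d)" for m k c d
  proof (cases "Poly_Mapping.lookup m i = 0")
    case False
    then have "m - Poly_Mapping.single i 1 + k = m + k - Poly_Mapping.single i 1"
      by (intro poly_mapping_eqI) (auto simp: lookup_add lookup_minus lookup_single when_def)
    then show ?thesis by (simp add: mult_single)
  qed simp
  have single: "pd i (?S m c * ?S k d) = pd i (?S m c) * ?S k d + ?S m c * pd i (?S k d)" for m k c d
  proof -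
    have "pd i (?S m c) * ?S k d + ?S m c * pd i (?S k d)
        = ?S (m + k - Poly_Mapping.single i 1) (of_nat (Poly_Mapping.lookup m i) * c * d)
          + ?S (k + m - Poly_Mapping.single i 1) (of_nat (Poly_Mapping.lookup k i) * d * c)"
      by (simp only: pd_single move mult.commute[of "?S m c"])
    also have "\<dots> = ?S (m + k - Poly_Mapping.single i 1)
        (of_nat (Poly_Mapping.lookup m i) * c * d + of_nat (Poly_Mapping.lookup k i) * d * c)"
      by (subst (2) add.commute) (simp only: single_add)
    also have "of_nat (Poly_Mapping.lookup m i) * c * d + of_nat (Poly_Mapping.lookup k i) * d * c
        = of_nat (Poly_Mapping.lookup (m + k) i) * (c * d)"
      by (simp add: lookup_add algebra_simps)
    finally show ?thesis
      by (simp only: mult_single pd_single)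
  qed
  have sum_single: "pd i ((\<Sum>m\<in>K. ?S m (f m)) * ?S k d)
      = pd i (\<Sum>m\<in>K. ?S m (f m)) * ?S k d + (\<Sum>m\<in>K. ?S m (f m)) * pd i (?S k d)" for K f k d
    by (simp add: sum_distrib_right pd_sum single sum.distrib)
  have "pd i (p * ?S k d) = pd i p * ?S k d + p * pd i (?S k d)" for k d
    using sum_single[where f = "Poly_Mapping.lookup p" and K = "Poly_Mapping.keys p"]
    by (simp only: mpoly_eq_sum_single[symmetric])
  then have "pd i (p * (\<Sum>m\<in>K. ?S m (f m)))
      = pd i p * (\<Sum>m\<in>K. ?S m (f m)) + p * pd i (\<Sum>m\<in>K. ?S m (f m))" for K f
    by (simp add: sum_distrib_left pd_sum sum.distrib)
  from this[of "Poly_Mapping.lookup q" "Poly_Mapping.keys q"] show ?thesis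
    by (simp only: mpoly_eq_sum_single[symmetric])
qed

lemma pd_const [simp]: "pd i (const c) = 0"
  by (simp add: const_def pd_single)

lemma pd_const_mult: "pd i (const c * p) = const c * pd i p"
  by (simp add: pd_mult)

lemma pd_var: "pd i (var j) = (if i = j then 1 else 0)"
  by (simp add: var_def pd_single lookup_single when_def)

lemma Apoly_pd [simp]: "p \<in> Apoly n \<Longrightarrow> pd i p \<in> Apoly n"
  by (induction p rule: Apoly_induct) (auto simp: pd_add pd_mult pd_var)

section \<open>Determinants\<close>

lemma detn_eq_det: "detn n M = det (mat n n (\<lambda>(i, j). M i j))"
proof -
  have "(\<Prod>i<n. M i (p i)) = (\<Prod>i = 0..<n. mat n n (\<lambda>(i, j). M i j) $$ (i, p i))"
    if "p permutes {..<n}" for p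
    using that by (intro prod.cong) (auto simp: lessThan_atLeast0 permutes_in_image[of p])
  then show ?thesis
    unfolding detn_def det_def by (simp add: lessThan_atLeast0)
qed

lemma detn_cong: "(\<And>i j. i < n \<Longrightarrow> j < n \<Longrightarrow> M i j = N i j) \<Longrightarrow> detn n M = detn n N"
  unfolding detn_eq_det by (intro arg_cong[of _ _ det] eq_matI) auto

lemma detn_split_row:
  assumes "r < n"
  shows "detn n (M(r := v)) = (\<Sum>\<sigma> | \<sigma> permutes {..<n}. v (\<sigma> r) * (of_int (sign \<sigma>) * (\<Prod>i\<in>{..<n} - {r}. M i (\<sigma> i))))"
  unfolding detn_def
  by (intro sum.cong refl, subst prod.remove[of _ r])
    (use assms in \<open>auto simp: ac_simps intro!: prod.cong\<close>)

lemma detn_row_add: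
  "r < n \<Longrightarrow> detn n (M(r := (\<lambda>j. u j + v j))) = detn n (M(r := u)) + detn n (M(r := v))"
  by (simp add: detn_split_row sum.distrib algebra_simps)

lemma detn_row_scale:
  "r < n \<Longrightarrow> detn n (M(r := (\<lambda>j. c * v j))) = c * detn n (M(r := v))"
  by (simp add: detn_split_row sum_distrib_left algebra_simps)

lemma detn_identical_rows:
  assumes "i \<noteq> j" "i < n" "j < n" "M i = M j"
  shows "detn n M = 0"
  unfolding detn_eq_det
  by (rule det_identical_rows[of _ n i j]) (use assms in \<open>auto intro!: eq_vecI\<close>)

text \<open>Cramer's rule without division, from adj(A) A = det(A): over any commutative ring it
  expands \<open>v\<close> in the rows of \<open>M\<close>. It will expand the gradient of a
  function in the gradients of local coordinates.\<close>

lemma detn_cramer: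
  fixes M :: "nat \<Rightarrow> nat \<Rightarrow> 'a::comm_ring_1"
  assumes k: "k < n"
  shows "detn n M * v k = (\<Sum>r<n. detn n (M(r := v)) * M r k)"
proof -
  let ?A = "mat n n (\<lambda>(i, j). M i j)"
  have A: "?A \<in> carrier_mat n n" by simp
  have row: "detn n (M(r := v)) = (\<Sum>j<n. v j * cofactor ?A r j)" if r: "r < n" for r
  proof -
    let ?B = "mat n n (\<lambda>(i, j). (M(r := v)) i j)"
    have "mat_delete ?B r j = mat_delete ?A r j" for j
      unfolding mat_delete_def by (intro eq_matI) auto
    then show ?thesis
      using laplace_expansion_row[of ?B n r] r by (simp add: detn_eq_det cofactor_def)
  qed
  have adj: "(\<Sum>r<n. cofactor ?A r j * M r k) = (if j = k then detn n M else 0)" if j: "j < n" for j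
  proof -
    have "(adj_mat ?A * ?A) $$ (j, k) = (\<Sum>r<n. cofactor ?A r j * M r k)"
      using j k by (simp add: adj_mat_def scalar_prod_def lessThan_atLeast0)
    then show ?thesis
      using j k by (auto simp: adj_mat(3)[OF A] detn_eq_det)
  qed
  have "(\<Sum>r<n. detn n (M(r := v)) * M r k) = (\<Sum>r<n. \<Sum>j<n. v j * (cofactor ?A r j * M r k))"
    by (simp add: row sum_distrib_right mult.assoc)
  also have "\<dots> = (\<Sum>j<n. v j * (\<Sum>r<n. cofactor ?A r j * M r k))"
    by (subst sum.swap) (simp add: sum_distrib_left)
  also have "\<dots> = (\<Sum>j<n. if j = k then v j * detn n M else 0)"
    by (intro sum.cong refl) (simp add: adj)
  also have "\<dots> = detn n M * v k"
    using k by (simp add: ac_simps)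
  finally show ?thesis by simp
qed

lemma detn_Apoly: "(\<And>i j. i < n \<Longrightarrow> j < n \<Longrightarrow> M i j \<in> Apoly k) \<Longrightarrow> detn n M \<in> Apoly k"
  unfolding detn_def
  by (intro Apoly_sum Apoly_mult Apoly_of_int Apoly_prod) (auto dest: permutes_in_image)

section \<open>Ideals and the Nullstellensatz\<close>

lemma ideal_subset: "is_ideal n I \<Longrightarrow> a \<in> I \<Longrightarrow> a \<in> Apoly n"
  by (auto simp: is_ideal_def)

lemma ideal_zero: "is_ideal n I \<Longrightarrow> 0 \<in> I"
  by (simp add: is_ideal_def)

lemma ideal_add: "is_ideal n I \<Longrightarrow> a \<in> I \<Longrightarrow> b \<in> I \<Longrightarrow> a + b \<in> I"
  by (simp add: is_ideal_def)

lemma ideal_mult: "is_ideal n I \<Longrightarrow> a \<in> I \<Longrightarrow> r \<in> Apoly n \<Longrightarrow> r * a \<in> I"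
  by (simp add: is_ideal_def)

lemma ideal_mult_right: "is_ideal n I \<Longrightarrow> a \<in> I \<Longrightarrow> r \<in> Apoly n \<Longrightarrow> a * r \<in> I"
  using ideal_mult[of n I a r] by (simp add: mult.commute)

lemma ideal_uminus: "is_ideal n I \<Longrightarrow> a \<in> I \<Longrightarrow> - a \<in> I"
  using ideal_mult[of n I a "- 1"] by simp

lemma ideal_diff: "is_ideal n I \<Longrightarrow> a \<in> I \<Longrightarrow> b \<in> I \<Longrightarrow> a - b \<in> I"
  using ideal_add[of n I a "- b"] ideal_uminus[of n I b] by simp

lemma ideal_sum: "is_ideal n I \<Longrightarrow> (\<And>x. x \<in> S \<Longrightarrow> f x \<in> I) \<Longrightarrow> sum f S \<in> I"
  by (induction S rule: infinite_finite_induct) (auto intro: ideal_zero ideal_add)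

lemma ideal_add_cancel: "is_ideal n I \<Longrightarrow> a - b \<in> I \<Longrightarrow> b \<in> I \<Longrightarrow> a \<in> I"
  using ideal_add[of n I "a - b" b] by simp

lemma ideal_eq_Apoly: "is_ideal n I \<Longrightarrow> 1 \<in> I \<Longrightarrow> I = Apoly n"
  using ideal_mult[of n I 1] ideal_subset[of n I] by auto

lemma const_in_ideal: "is_ideal n I \<Longrightarrow> I \<noteq> Apoly n \<Longrightarrow> const c \<in> I \<Longrightarrow> c = 0"
  using ideal_mult[of n I "const c" "const (inverse c)"] const_inverse_mult[of c 1] ideal_eq_Apoly[of n I]
  by auto

lemma ideal_const_mult_cancel: "is_ideal n I \<Longrightarrow> c \<noteq> 0 \<Longrightarrow> const c * a \<in> I \<Longrightarrow> a \<in> I"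
  using ideal_mult[of n I "const c * a" "const (inverse c)"] const_inverse_mult[of c a] by auto

lemma prime_ideal: "is_prime_ideal n P \<Longrightarrow> is_ideal n P"
  by (simp add: is_prime_ideal_def)

lemma prime_one: "is_prime_ideal n P \<Longrightarrow> 1 \<notin> P"
  using ideal_eq_Apoly by (auto simp: is_prime_ideal_def)

lemma prime_mult: "is_prime_ideal n P \<Longrightarrow> a \<in> Apoly n \<Longrightarrow> b \<in> Apoly n \<Longrightarrow> a * b \<in> P \<Longrightarrow> a \<in> P \<or> b \<in> P"
  by (simp add: is_prime_ideal_def)

lemma prime_cancel: "is_prime_ideal n P \<Longrightarrow> b * x \<in> P \<Longrightarrow> b \<in> Apoly n \<Longrightarrow> b \<notin> P \<Longrightarrow> x \<in> Apoly n \<Longrightarrow> x \<in> P"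
  using prime_mult by blast

lemma prime_power: "is_prime_ideal n P \<Longrightarrow> a \<in> Apoly n \<Longrightarrow> a ^ k \<in> P \<Longrightarrow> a \<in> P"
proof (induction k)
  case 0
  then show ?case using prime_one by simp
next
  case (Suc k)
  then show ?case using prime_mult[of n P a "a ^ k"] by auto
qed

lemma chain_Union_ideal:
  assumes "C \<noteq> {}" "\<And>I. I \<in> C \<Longrightarrow> is_ideal n I" "\<And>I J. I \<in> C \<Longrightarrow> J \<in> C \<Longrightarrow> I \<subseteq> J \<or> J \<subseteq> I"
  shows "is_ideal n (\<Union>C)"
  unfolding is_ideal_def
proof (intro conjI ballI)
  fix a b assume "a \<in> \<Union>C" "b \<in> \<Union>C"
  then obtain I J where "I \<in> C" "J \<in> C" "a \<in> I" "b \<in> J" by blast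
  then show "a + b \<in> \<Union>C"
    using assms(3)[of I J] ideal_add[OF assms(2), of I a b] ideal_add[OF assms(2), of J a b] by blast
next
  show "\<Union>C \<subseteq> Apoly n"
    using assms(2) ideal_subset by blast
  show "0 \<in> \<Union>C"
    using assms(1,2) ideal_zero by blast
  show "r * a \<in> \<Union>C" if "a \<in> \<Union>C" "r \<in> Apoly n" for a r
    using that assms(2) ideal_mult by blast
qed

section \<open>Sums of ideals and principal ideals\<close>

definition isum :: "mpoly set \<Rightarrow> mpoly set \<Rightarrow> mpoly set" where
  "isum I J = {a + b | a b. a \<in> I \<and> b \<in> J}"

lemma isumI: "a \<in> I \<Longrightarrow> b \<in> J \<Longrightarrow> a + b \<in> isum I J"
  by (auto simp: isum_def)

lemma isum_ideal:
  assumes I: "is_ideal n I" and J: "is_ideal n J"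
  shows "is_ideal n (isum I J)"
  unfolding is_ideal_def
proof (intro conjI ballI)
  show "isum I J \<subseteq> Apoly n"
    using ideal_subset[OF I] ideal_subset[OF J] by (auto simp: isum_def)
  show "0 \<in> isum I J"
    using isumI[OF ideal_zero[OF I] ideal_zero[OF J]] by simp
  fix x assume "x \<in> isum I J"
  then obtain a b where x: "x = a + b" "a \<in> I" "b \<in> J" by (auto simp: isum_def)
  show "x + y \<in> isum I J" if y: "y \<in> isum I J" for y
  proof -
    from y obtain c d where "y = c + d" "c \<in> I" "d \<in> J" by (auto simp: isum_def)
    then show ?thesis
      using isumI[OF ideal_add[OF I x(2)] ideal_add[OF J x(3)], of c d] x by (simp add: ac_simps)
  qed
  show "r * x \<in> isum I J" if "r \<in> Apoly n" for r
    using isumI[OF ideal_mult[OF I x(2) that] ideal_mult[OF J x(3) that]] x by (simp add: algebra_simps)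
qed

lemma isum_left: "is_ideal n J \<Longrightarrow> a \<in> I \<Longrightarrow> a \<in> isum I J"
  using isumI[of a I 0 J] ideal_zero[of n J] by simp

lemma isum_right: "is_ideal n I \<Longrightarrow> a \<in> J \<Longrightarrow> a \<in> isum I J"
  using isumI[of 0 I a J] ideal_zero[of n I] by simp

definition principal :: "nat \<Rightarrow> mpoly \<Rightarrow> mpoly set" where
  "principal n a = {r * a | r. r \<in> Apoly n}"

lemma principal_ideal: "a \<in> Apoly n \<Longrightarrow> is_ideal n (principal n a)"
  unfolding is_ideal_def principal_def
  by (auto simp: distrib_right[symmetric] mult.assoc[symmetric] intro: exI[of _ 0])

lemma principalI: "r \<in> Apoly n \<Longrightarrow> r * a \<in> principal n a"
  by (auto simp: principal_def)

lemma principal_self: "a \<in> principal n a"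
  using principalI[of 1 n a] by simp

lemma mem_isum_principal: "x \<in> isum I (principal n a) \<longleftrightarrow> (\<exists>r\<in>Apoly n. x - r * a \<in> I)"
proof
  show "\<exists>r\<in>Apoly n. x - r * a \<in> I" if "x \<in> isum I (principal n a)"
    using that by (auto simp: isum_def principal_def intro!: bexI)
  show "x \<in> isum I (principal n a)" if "\<exists>r\<in>Apoly n. x - r * a \<in> I"
  proof -
    from that obtain r where "r \<in> Apoly n" "x - r * a \<in> I" by blast
    then show ?thesis
      using isumI[OF _ principalI, of "x - r * a" I r n a] by simp
  qed
qed

section \<open>The Nullstellensatz by counting dimensions\<close>

lemma linear_dependence:
  fixes v :: "'c \<Rightarrow> 'b \<Rightarrow> 'a::field"
  assumes "finite B" "finite S" "card B < card S"
  shows "\<exists>l. (\<exists>c\<in>S. l c \<noteq> 0) \<and> (\<forall>m\<in>B. (\<Sum>c\<in>S. l c * v c m) = 0)"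
  using assms
proof (induction B arbitrary: S v rule: finite_induct)
  case empty
  then show ?case by (intro exI[of _ "\<lambda>_. 1"]) (auto simp: card_gt_0_iff)
next
  case (insert m B)
  show ?case
  proof (cases "\<forall>c\<in>S. v c m = 0")
    case True
    then show ?thesis
      using insert.IH[OF insert.prems(1), of v] insert by auto
  next
    case False
    then obtain c0 where c0: "c0 \<in> S" "v c0 m \<noteq> 0" by blast
    define T where "T = S - {c0}"
    \<comment> \<open>Elimination of the coordinate \<open>m\<close> with pivot
      \<open>v c0 m\<close>; the value \<open>l' c0\<close> below absorbs the multiples of
      \<open>v c0\<close> that are subtracted here.\<close>
    define w where "w c k = v c k - v c m / v c0 m * v c0 k" for c k
    have "card B < card T"
      using insert c0 by (simp add: T_def)
    with insert.IH[of T w] insert.prems obtain l where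
      l: "\<exists>c\<in>T. l c \<noteq> 0" "\<forall>k\<in>B. (\<Sum>c\<in>T. l c * w c k) = 0"
      by (auto simp: T_def)
    define l' where "l' = l(c0 := - (\<Sum>c\<in>T. l c * (v c m / v c0 m)))"
    have "(\<Sum>c\<in>S. l' c * v c k) = (\<Sum>c\<in>T. l c * w c k)" for k
    proof -
      have "(\<Sum>c\<in>S. l' c * v c k) = l' c0 * v c0 k + (\<Sum>c\<in>T. l' c * v c k)"
        unfolding T_def using insert.prems c0 by (intro sum.remove) auto
      also have "(\<Sum>c\<in>T. l' c * v c k) = (\<Sum>c\<in>T. l c * v c k)"
        by (rule sum.cong) (auto simp: T_def l'_def)
      finally show ?thesis
        by (simp add: w_def l'_def[THEN fun_cong] sum_distrib_right sum_subtractf right_diff_distrib mult.assoc)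
    qed
    moreover have "w c m = 0" for c
      using c0 by (simp add: w_def)
    moreover have "\<exists>c\<in>S. l' c \<noteq> 0"
      using l(1) by (auto simp: T_def l'_def)
    ultimately show ?thesis
      using l(2) by (intro exI[of _ l']) auto
  qed
qed

definition poly_at :: "mpoly \<Rightarrow> complex poly \<Rightarrow> mpoly" where
  "poly_at a p = poly (map_poly const p) a"

lemma poly_at_0 [simp]: "poly_at a 0 = 0"
  by (simp add: poly_at_def)

lemma poly_at_pCons [simp]: "poly_at a (pCons c p) = const c + a * poly_at a p"
  by (simp add: poly_at_def map_poly_pCons)

lemma poly_at_add: "poly_at a (p + q) = poly_at a p + poly_at a q"
  by (induction p q rule: poly_induct2) (simp_all add: const_add algebra_simps)

lemma poly_at_smult: "poly_at a (Polynomial.smult c p) = const c * poly_at a p"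
  by (induction p) (simp_all add: const_mult algebra_simps)

lemma poly_at_mult: "poly_at a (p * q) = poly_at a p * poly_at a q"
  by (induction p) (simp_all add: poly_at_add poly_at_smult algebra_simps)

lemma poly_at_1 [simp]: "poly_at a 1 = 1"
  by (simp add: one_pCons)

lemma poly_at_sum: "poly_at a (sum f S) = (\<Sum>x\<in>S. poly_at a (f x))"
  by (induction S rule: infinite_finite_induct) (simp_all add: poly_at_add)

lemma poly_at_prod: "poly_at a (prod f S) = (\<Prod>x\<in>S. poly_at a (f x))"
  by (induction S rule: infinite_finite_induct) (simp_all add: poly_at_mult)

lemma poly_at_Apoly [simp]: "a \<in> Apoly n \<Longrightarrow> poly_at a p \<in> Apoly n"
  by (induction p) auto

text \<open>Over \<complex> the polynomial splits into linear factors, and primeness selects one of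
  them.\<close>

lemma prime_poly_at:
  assumes P: "is_prime_ideal n P" and a: "a \<in> Apoly n" and "p \<noteq> 0" "poly_at a p \<in> P"
  shows "\<exists>c. a - const c \<in> P"
  using assms(3,4)
proof (induction "Polynomial.degree p" arbitrary: p rule: less_induct)
  case less
  show ?case
  proof (cases "Polynomial.degree p = 0")
    case True
    then obtain c where "p = [:c:]" by (metis degree_eq_zeroE)
    then show ?thesis
      using less.prems const_in_ideal[OF prime_ideal[OF P], of c] P by (auto simp: is_prime_ideal_def)
  next
    case False
    then have "\<not> constant (poly p)" by (simp add: constant_degree)
    then obtain z where "poly p z = 0" using fundamental_theorem_of_algebra by blast
    then obtain q where q: "p = [:-z, 1:] * q" by (metis poly_eq_0_iff_dvd dvdE)
    then have "q \<noteq> 0" using less.prems by auto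
    moreover from this have "Polynomial.degree q < Polynomial.degree p"
      unfolding q by (subst degree_mult_eq) auto
    moreover have "poly_at a p = (a - const z) * poly_at a q"
      by (simp only: q poly_at_mult) (simp add: const_uminus)
    ultimately show ?thesis
      using less prime_mult[OF P, of "a - const z" "poly_at a q"] a by auto
  qed
qed

lemma finite_bounded_monomials:
  "finite {m :: nat \<Rightarrow>\<^sub>0 nat. Poly_Mapping.keys m \<subseteq> {..<n} \<and> (\<forall>i. Poly_Mapping.lookup m i \<le> N)}"
proof -
  have "finite {f :: nat \<Rightarrow> nat. \<forall>x. (x \<in> {..<n} \<longrightarrow> f x \<in> {..N}) \<and> (x \<notin> {..<n} \<longrightarrow> f x = 0)}"
    by (rule finite_set_of_finite_funs) auto
  then have "finite (Poly_Mapping.lookup ` {m. Poly_Mapping.keys m \<subseteq> {..<n} \<and> (\<forall>i. Poly_Mapping.lookup m i \<le> N)})"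
    by (rule rev_finite_subset) (auto simp: in_keys_iff)
  then show ?thesis
    by (rule finite_imageD) (simp add: inj_on_def lookup_inject)
qed

text \<open>Together with \<open>finite_bounded_monomials\<close> this exhausts the polynomial ring
  in n variables by a sequence of finite-dimensional spaces.\<close>

lemma exponents_bounded:
  "\<exists>N. \<forall>m\<in>Poly_Mapping.keys (p::mpoly). \<forall>i. Poly_Mapping.lookup m i \<le> N"
proof (intro exI ballI allI)
  fix m i assume m: "m \<in> Poly_Mapping.keys p"
  have "Poly_Mapping.lookup m i \<le> (\<Sum>i\<in>Poly_Mapping.keys m. Poly_Mapping.lookup m i)"
    by (cases "i \<in> Poly_Mapping.keys m") (auto simp: in_keys_iff intro: member_le_sum)
  also have "\<dots> \<le> (\<Sum>m\<in>Poly_Mapping.keys p. \<Sum>i\<in>Poly_Mapping.keys m. Poly_Mapping.lookup m i)"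
    using m by (intro member_le_sum) auto
  finally show "Poly_Mapping.lookup m i
      \<le> (\<Sum>m\<in>Poly_Mapping.keys p. \<Sum>i\<in>Poly_Mapping.keys m. Poly_Mapping.lookup m i)" .
qed

text \<open>The field of complex numbers is uncountable, whereas the polynomial ring has countable
  dimension. Hence the would-be inverses of the elements a - c cannot be linearly independent.\<close>

lemma prime_avoiding_powers_residue_const:
  assumes M: "is_prime_ideal n M" and g: "g \<in> Apoly n" "g \<notin> M"
    and inv: "\<And>h. h \<in> Apoly n \<Longrightarrow> h \<notin> M \<Longrightarrow> \<exists>k. \<exists>b\<in>Apoly n. g ^ k - b * h \<in> M"
    and a: "a \<in> Apoly n"
  shows "\<exists>c. a - const c \<in> M"
proof (rule ccontr)
  assume neg: "\<not> ?thesis"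
  have "\<exists>k b N. b \<in> Apoly n \<and> g ^ k - b * (a - const c) \<in> M
      \<and> (\<forall>m\<in>Poly_Mapping.keys b. \<forall>i. Poly_Mapping.lookup m i \<le> N)" for c
    using inv[of "a - const c"] neg a exponents_bounded by fastforce
  then obtain k b N where kbN: "\<And>c. b c \<in> Apoly n" "\<And>c. g ^ k c - b c * (a - const c) \<in> M"
    "\<And>c m i. m \<in> Poly_Mapping.keys (b c) \<Longrightarrow> Poly_Mapping.lookup m i \<le> N c"
    by metis
  \<comment> \<open>There are uncountably many \<open>c\<close> but only countably many pairs (k,
    N), so infinitely many would-be inverses share an exponent \<open>k0\<close> and lie in one
    finite-dimensional space.\<close>
  have "\<exists>k0 N0. infinite {c. k c = k0 \<and> N c = N0}"
  proof (rule ccontr)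
    assume "\<not> ?thesis"
    then have "countable (\<Union>(k0, N0)\<in>UNIV. {c. k c = k0 \<and> N c = N0})"
      by (intro countable_UN) (auto intro: countable_finite)
    moreover have "(\<Union>(k0, N0)\<in>UNIV. {c. k c = k0 \<and> N c = N0}) = (UNIV :: complex set)"
      by auto
    ultimately have "countable (complex_of_real ` UNIV)"
      by (metis countable_subset subset_UNIV)
    then have "countable (UNIV :: real set)"
      by (rule countable_image_inj_on) (simp add: inj_on_def)
    then show False
      using uncountable_UNIV_real by simp
  qed
  then obtain k0 N0 where inf: "infinite {c. k c = k0 \<and> N c = N0}" by blast
  define B where "B = {m :: nat \<Rightarrow>\<^sub>0 nat. Poly_Mapping.keys m \<subseteq> {..<n} \<and> (\<forall>i. Poly_Mapping.lookup m i \<le> N0)}"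
  have fB: "finite B" unfolding B_def by (rule finite_bounded_monomials)
  obtain S where S: "S \<subseteq> {c. k c = k0 \<and> N c = N0}" "finite S" "card S = Suc (card B)"
    using infinite_arbitrarily_large[OF inf] by blast
  obtain l where l: "\<exists>c\<in>S. l c \<noteq> 0" "\<forall>m\<in>B. (\<Sum>c\<in>S. l c * Poly_Mapping.lookup (b c) m) = 0"
    using linear_dependence[OF fB S(2), of "\<lambda>c. Poly_Mapping.lookup (b c)"] S(3) by auto
  have keysB: "Poly_Mapping.keys (b c) \<subseteq> B" if "c \<in> S" for c
    using that S(1) kbN(1)[of c] kbN(3)[of _ c] by (auto simp: B_def Apoly_def)
  have lookup_const_mult: "Poly_Mapping.lookup (const x * p) m = x * Poly_Mapping.lookup p m" for x p m
    unfolding const_def mult_map_scale_conv_mult[symmetric] by (simp add: Poly_Mapping.map.rep_eq when_def)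
  have comb0: "(\<Sum>c\<in>S. const (l c) * b c) = 0"
  proof (rule poly_mapping_eqI)
    fix m
    show "Poly_Mapping.lookup (\<Sum>c\<in>S. const (l c) * b c) m = Poly_Mapping.lookup 0 m"
    proof (cases "m \<in> B")
      case False
      then have "Poly_Mapping.lookup (b c) m = 0" if "c \<in> S" for c
        using keysB[OF that] by (auto simp: in_keys_iff)
      then show ?thesis by (simp add: lookup_sum lookup_const_mult)
    qed (use l(2) in \<open>simp add: lookup_sum lookup_const_mult\<close>)
  qed
  \<comment> \<open>The numerator of the partial fraction sum of \<open>l c\<close> / (X - c). Its
    value at a \<open>c\<close> with \<open>l c \<noteq> 0\<close> is \<open>l c\<close> times a
    nonzero product, hence \<open>p \<noteq> 0\<close>.\<close>
  define p where "p = (\<Sum>c\<in>S. Polynomial.smult (l c) (\<Prod>d\<in>S - {c}. [:- d, 1:]))"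
  have "p \<noteq> 0"
  proof -
    obtain c where c: "c \<in> S" "l c \<noteq> 0" using l(1) by blast
    have "poly p c = (\<Sum>c'\<in>S. l c' * (\<Prod>d\<in>S - {c'}. c - d))"
      by (simp add: p_def poly_sum poly_prod)
    also have "\<dots> = (\<Sum>c'\<in>S. if c' = c then l c * (\<Prod>d\<in>S - {c}. c - d) else 0)"
    proof (rule sum.cong[OF refl])
      fix c' assume "c' \<in> S"
      have "(\<Prod>d\<in>S - {c'}. c - d) = 0" if "c' \<noteq> c"
        using that c S(2) by (intro prod_zero) auto
      then show "l c' * (\<Prod>d\<in>S - {c'}. c - d) = (if c' = c then l c * (\<Prod>d\<in>S - {c}. c - d) else 0)"
        by auto
    qed
    also have "\<dots> = l c * (\<Prod>d\<in>S - {c}. c - d)"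
      using c S(2) by simp
    also have "\<dots> \<noteq> 0" using c S(2) by auto
    finally show ?thesis by auto
  qed
  define R where "R c = (\<Prod>d\<in>S - {c}. a - const d)" for c
  have R: "R c \<in> Apoly n" for c by (auto simp: R_def a)
  have "poly_at a p = (\<Sum>c\<in>S. const (l c) * R c)"
    by (simp add: p_def poly_at_sum poly_at_smult poly_at_prod const_uminus R_def)
  then have "g ^ k0 * poly_at a p = (\<Sum>c\<in>S. const (l c) * R c * g ^ k0)"
    by (simp add: sum_distrib_left ac_simps)
  \<comment> \<open>Replacing \<open>g ^ k0\<close> by \<open>b c * (a - const c)\<close> costs an
    element of \<open>M\<close> and completes \<open>R c\<close> to the product over all of
    \<open>S\<close>; the linear relation among the \<open>b c\<close> then annihilates the second
    sum.\<close>
  also have "\<dots> = (\<Sum>c\<in>S. const (l c) * R c * (g ^ k0 - b c * (a - const c)))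
      + (\<Sum>c\<in>S. const (l c) * b c * (R c * (a - const c)))"
    by (simp add: sum.distrib[symmetric] algebra_simps)
  also have "(\<Sum>c\<in>S. const (l c) * b c * (R c * (a - const c)))
      = (\<Sum>c\<in>S. const (l c) * b c) * (\<Prod>d\<in>S. a - const d)"
  proof -
    have "R c * (a - const c) = (\<Prod>d\<in>S. a - const d)" if "c \<in> S" for c
      using prod.remove[OF S(2) that, of "\<lambda>d. a - const d"] by (simp add: R_def mult.commute)
    then show ?thesis by (simp add: sum_distrib_right)
  qed
  finally have "g ^ k0 * poly_at a p = (\<Sum>c\<in>S. const (l c) * R c * (g ^ k0 - b c * (a - const c)))"
    by (simp add: comb0)
  moreover have "g ^ k0 - b c * (a - const c) \<in> M" if "c \<in> S" for c
    using kbN(2)[of c] S(1) that by auto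
  ultimately have "g ^ k0 * poly_at a p \<in> M"
    using R by (auto intro!: ideal_sum[OF prime_ideal[OF M]] ideal_mult[OF prime_ideal[OF M]])
  then have "poly_at a p \<in> M"
    using prime_mult[OF M, of "g ^ k0" "poly_at a p"] prime_power[OF M, of g k0] g a by auto
  then show False
    using prime_poly_at[OF M a \<open>p \<noteq> 0\<close>] neg by blast
qed

text \<open>The quotient consists of constants, so a strictly larger ideal contains a nonzero
  constant.\<close>

lemma maximal_if_residue_const:
  assumes M: "is_ideal n M" "M \<noteq> Apoly n" and c: "\<And>a. a \<in> Apoly n \<Longrightarrow> \<exists>c. a - const c \<in> M"
  shows "is_maximal_ideal n M"
  unfolding is_maximal_ideal_def
proof (intro conjI allI impI M)
  fix I assume I: "is_ideal n I \<and> M \<subseteq> I"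
  show "I = M \<or> I = Apoly n"
  proof (rule ccontr)
    assume neg: "\<not> ?thesis"
    then obtain a where a: "a \<in> I" "a \<notin> M" using I by blast
    then obtain c where c: "a - const c \<in> M" using assms(3) I ideal_subset by blast
    then have "const c \<in> I"
      using I a ideal_diff[of n I a "a - const c"] by auto
    then have "c = 0" using const_in_ideal[of n I c] I neg by auto
    then show False using a c by simp
  qed
qed

text \<open>The maximality condition makes every element outside \<open>M\<close> invertible modulo
  \<open>M\<close> once \<open>g\<close> is inverted, and then the counting argument applies. The
  case \<open>g = 1\<close> is the Nullstellensatz for maximal ideals; general \<open>g\<close>
  gives the Jacobson property.\<close>

lemma maximal_avoiding_powers:
  assumes M: "is_ideal n M" and g: "g \<in> Apoly n" "\<And>k. g ^ k \<notin> M"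
    and max: "\<And>I. is_ideal n I \<Longrightarrow> M \<subseteq> I \<Longrightarrow> (\<And>k. g ^ k \<notin> I) \<Longrightarrow> I = M"
  shows "is_prime_ideal n M" "is_maximal_ideal n M" "\<And>a. a \<in> Apoly n \<Longrightarrow> \<exists>c. a - const c \<in> M"
proof -
  have inv: "\<exists>k. \<exists>b\<in>Apoly n. g ^ k - b * h \<in> M" if h: "h \<in> Apoly n" "h \<notin> M" for h
  proof (rule ccontr)
    assume neg: "\<not> ?thesis"
    have "isum M (principal n h) = M"
    proof (rule max)
      show "is_ideal n (isum M (principal n h))"
        by (rule isum_ideal[OF M principal_ideal[OF h(1)]])
      show "M \<subseteq> isum M (principal n h)"
        using isum_left[OF principal_ideal[OF h(1)]] by blast
      show "g ^ k \<notin> isum M (principal n h)" for k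
        using neg by (auto simp: mem_isum_principal)
    qed
    then show False
      using h isum_right[OF M principal_self[of h n]] by simp
  qed
  have proper: "M \<noteq> Apoly n" using g by auto
  show prime: "is_prime_ideal n M"
    unfolding is_prime_ideal_def
  proof (intro conjI ballI impI M proper)
    fix x y assume xy: "x \<in> Apoly n" "y \<in> Apoly n" "x * y \<in> M"
    show "x \<in> M \<or> y \<in> M"
    proof (rule ccontr)
      assume "\<not> ?thesis"
      then obtain k b l d where kl: "b \<in> Apoly n" "g ^ k - b * x \<in> M" "d \<in> Apoly n" "g ^ l - d * y \<in> M"
        using inv[of x] inv[of y] xy by blast
      \<comment> \<open>Modulo \<open>M\<close> the powers \<open>g ^ k\<close> and
        \<open>g ^ l\<close> are multiples of \<open>x\<close> and \<open>y\<close>, so their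
        product is a multiple of \<open>x * y\<close>.\<close>
      have "g ^ (k + l) = g ^ l * (g ^ k - b * x) + b * x * (g ^ l - d * y) + b * d * (x * y)"
        by (simp add: power_add algebra_simps)
      then have "g ^ (k + l) \<in> M"
        using ideal_mult[OF M kl(2), of "g ^ l"] ideal_mult[OF M kl(4), of "b * x"]
          ideal_mult[OF M xy(3), of "b * d"] kl(1,3) xy(1) g(1) ideal_add[OF M] by simp
      then show False using g by blast
    qed
  qed
  show c: "\<exists>c. a - const c \<in> M" if "a \<in> Apoly n" for a
    using prime_avoiding_powers_residue_const[OF prime g(1) _ inv that] g(2)[of 1] by auto
  show "is_maximal_ideal n M"
    by (rule maximal_if_residue_const[OF M proper c])
qed

lemma maximal_residue_const: "is_maximal_ideal n M \<Longrightarrow> a \<in> Apoly n \<Longrightarrow> \<exists>c. a - const c \<in> M"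
  by (rule maximal_avoiding_powers(3)[of n M 1]) (auto simp: is_maximal_ideal_def dest: ideal_eq_Apoly)

lemma maximal_prime: "is_maximal_ideal n M \<Longrightarrow> is_prime_ideal n M"
  by (rule maximal_avoiding_powers(1)[of n M 1]) (auto simp: is_maximal_ideal_def dest: ideal_eq_Apoly)

text \<open>Zorn's lemma is applied to ideals that avoid all powers of \<open>g\<close>, not only
  \<open>g\<close>, which is what \<open>maximal_avoiding_powers\<close> requires. \<open>P\<close>
  itself is such an ideal because it is prime.\<close>

lemma maximal_above_prime:
  assumes P: "is_prime_ideal n P" and g: "g \<in> Apoly n" "g \<notin> P"
  obtains M where "is_maximal_ideal n M" "P \<subseteq> M" "g \<notin> M"
proof -
  let ?F = "{I. is_ideal n I \<and> P \<subseteq> I \<and> (\<forall>k. g ^ k \<notin> I)}"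
  have "\<exists>M\<in>?F. \<forall>I\<in>?F. M \<subseteq> I \<longrightarrow> I = M"
  proof (rule subset_Zorn_nonempty)
    show "?F \<noteq> {}"
      using P g prime_ideal prime_power by blast
    fix C assume C: "C \<noteq> {}" "subset.chain ?F C"
    then have "is_ideal n (\<Union>C)"
      by (intro chain_Union_ideal) (auto simp: subset.chain_def)
    with C show "\<Union>C \<in> ?F"
      by (auto simp: subset.chain_def)
  qed
  then obtain M where M: "is_ideal n M" "P \<subseteq> M" "\<And>k. g ^ k \<notin> M"
    and max: "\<And>I. is_ideal n I \<Longrightarrow> P \<subseteq> I \<Longrightarrow> (\<And>k. g ^ k \<notin> I) \<Longrightarrow> M \<subseteq> I \<Longrightarrow> I = M"
    by auto
  have "is_maximal_ideal n M"
    by (rule maximal_avoiding_powers(2)[OF M(1) g(1) M(3)]) (use max M(2) in blast)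
  then show thesis
    using that M(2) M(3)[of 1] by auto
qed

section \<open>Ascending chains and the Krull intersection theorem\<close>

lemma nat_seq_incseq_subseq:
  fixes f :: "nat \<Rightarrow> nat"
  shows "\<exists>r. strict_mono r \<and> incseq (\<lambda>k. f (r k))"
proof -
  obtain r where r: "strict_mono r" "monoseq (\<lambda>k. f (r k))"
    using seq_monosub[of f] by blast
  consider "incseq (\<lambda>k. f (r k))" | "\<And>m n. m \<le> n \<Longrightarrow> f (r n) \<le> f (r m)"
    using r(2) unfolding monoseq_def incseq_def by blast
  then show ?thesis
  proof cases
    case 1
    then show ?thesis using r(1) by blast
  next
    case 2
    obtain k0 where k0: "\<And>k. f (r k0) \<le> f (r k)"
      using ex_has_least_nat[of "\<lambda>_. True" 0 "\<lambda>k. f (r k)"] by blast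
    have "f (r (k0 + k)) = f (r k0)" for k
      using 2[of k0 "k0 + k"] k0[of "k0 + k"] by simp
    then have "incseq (\<lambda>k. f (r (k0 + k)))"
      by (simp add: incseq_def)
    moreover have "strict_mono (\<lambda>k. r (k0 + k))"
      using r(1) by (simp add: strict_mono_def)
    ultimately show ?thesis by (intro exI[of _ "\<lambda>k. r (k0 + k)"]) simp
  qed
qed

lemma incseq_coordinates_subseq:
  fixes f :: "nat \<Rightarrow> nat \<Rightarrow> nat"
  shows "\<exists>r. strict_mono r \<and> (\<forall>i<n. incseq (\<lambda>k. f (r k) i))"
proof (induction n)
  case 0
  then show ?case by (intro exI[of _ id]) (simp add: strict_mono_def)
next
  case (Suc n)
  then obtain r where r: "strict_mono r" "\<And>i. i < n \<Longrightarrow> incseq (\<lambda>k. f (r k) i)" by blast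
  obtain q where q: "strict_mono q" "incseq (\<lambda>k. f (r (q k)) n)"
    using nat_seq_incseq_subseq[of "\<lambda>k. f (r k) n"] by blast
  have "incseq (\<lambda>k. f (r (q k)) i)" if "i < Suc n" for i
    using that q r(2)[of i] by (cases "i = n") (auto simp: incseq_def strict_mono_less_eq)
  moreover have "strict_mono (\<lambda>k. r (q k))"
    using r(1) q(1) by (simp add: strict_mono_def)
  ultimately show ?case by (intro exI[of _ "\<lambda>k. r (q k)"]) simp
qed

text \<open>Two consecutive terms of a coordinatewise nondecreasing subsequence suffice; the
  coordinates from n on are 0, so truncated subtraction of exponents is exact.\<close>

lemma dickson:
  fixes f :: "nat \<Rightarrow> nat \<Rightarrow>\<^sub>0 nat"
  assumes "\<And>k. Poly_Mapping.keys (f k) \<subseteq> {..<n}"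
  shows "\<exists>i j d. i < j \<and> f j = d + f i"
proof -
  obtain r where r: "strict_mono r" "\<And>i. i < n \<Longrightarrow> incseq (\<lambda>k. Poly_Mapping.lookup (f (r k)) i)"
    using incseq_coordinates_subseq[of n "\<lambda>k. Poly_Mapping.lookup (f k)"] by blast
  have "Poly_Mapping.lookup (f (r 0)) i \<le> Poly_Mapping.lookup (f (r 1)) i" for i
  proof (cases "i < n")
    case True
    then show ?thesis using r(2)[of i] by (simp add: incseq_def)
  next
    case False
    then have "i \<notin> Poly_Mapping.keys (f (r 0))" using assms by fastforce
    then show ?thesis by (simp add: in_keys_iff)
  qed
  then have "f (r 1) = (f (r 1) - f (r 0)) + f (r 0)"
    by (intro poly_mapping_eqI) (simp add: lookup_add lookup_minus)
  moreover have "r 0 < r 1" using r(1) by (simp add: strict_mono_def)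
  ultimately show ?thesis by blast
qed

text \<open>The order on exponent vectors is lexicographic, the variable of smallest index being
  decisive.\<close>

lemma monomial_nonneg: "(0 :: nat \<Rightarrow>\<^sub>0 nat) \<le> m"
proof (rule leI, rule notI)
  assume "m < 0"
  then show False by (auto simp: less_poly_mapping.rep_eq elim!: less_funE)
qed

text \<open>A divisor is never larger than its multiple, so Dickson's lemma excludes descending
  sequences. The bound on the variables is essential: the monomials \<open>var 0\<close>,
  \<open>var 1\<close>, \<open>var 2\<close>, ... descend forever.\<close>

lemma wf_monomials:
  "wf {(x :: nat \<Rightarrow>\<^sub>0 nat, y). x < y \<and> Poly_Mapping.keys x \<subseteq> {..<n} \<and> Poly_Mapping.keys y \<subseteq> {..<n}}"
  unfolding wf_iff_no_infinite_down_chain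
proof (rule notI, elim exE)
  fix f :: "nat \<Rightarrow> nat \<Rightarrow>\<^sub>0 nat"
  assume "\<forall>i. (f (Suc i), f i) \<in> {(x, y). x < y \<and> Poly_Mapping.keys x \<subseteq> {..<n} \<and> Poly_Mapping.keys y \<subseteq> {..<n}}"
  then have f: "f (Suc i) < f i" "Poly_Mapping.keys (f i) \<subseteq> {..<n}" for i by auto
  obtain i j d where ij: "i < j" "f j = d + f i"
    using dickson[of f n] f(2) by blast
  have "f i \<le> f j"
    using add_right_mono[OF monomial_nonneg[of d], of "f i"] ij by simp
  moreover have "f j < f i"
    using ij(1)
  proof (induction j)
    case (Suc j)
    then show ?case using f(1)[of j] by (cases "i = j") (auto intro: less_trans)
  qed simp
  ultimately show False by simp
qed

text \<open>For the zero polynomial this is \<open>Max {}\<close>, about which nothing is known, so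
  zero is treated separately throughout.\<close>

definition lead_mono :: "mpoly \<Rightarrow> (nat \<Rightarrow>\<^sub>0 nat)" where
  "lead_mono p = Max (Poly_Mapping.keys p)"

lemma lead_mono_in_keys: "p \<noteq> 0 \<Longrightarrow> lead_mono p \<in> Poly_Mapping.keys p"
  unfolding lead_mono_def by (rule Max_in) auto

lemma lookup_single_mult:
  "Poly_Mapping.lookup (Poly_Mapping.single d c * (p::mpoly)) (d + m) = c * Poly_Mapping.lookup p m"
proof -
  have "Poly_Mapping.single d c * (\<Sum>k\<in>K. Poly_Mapping.single k (f k))
      = (\<Sum>k\<in>K. Poly_Mapping.single (d + k) (c * f k))" for K f
    by (simp add: sum_distrib_left mult_single)
  from this[of "Poly_Mapping.lookup p" "Poly_Mapping.keys p"]
  have "Poly_Mapping.single d c * p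
      = (\<Sum>k\<in>Poly_Mapping.keys p. Poly_Mapping.single (d + k) (c * Poly_Mapping.lookup p k))"
    by (simp only: mpoly_eq_sum_single[symmetric])
  then show ?thesis
    by (simp add: lookup_sum lookup_single when_def sum.delta in_keys_iff)
qed

text \<open>One step of polynomial division: the coefficient cancels the leading terms, and
  compatibility of the order with addition keeps all other monomials below.\<close>

lemma lead_reduce:
  assumes p: "p \<noteq> 0" and q: "q \<noteq> 0" and d: "lead_mono q = d + lead_mono p"
  defines "r \<equiv> q - Poly_Mapping.single d
    (Poly_Mapping.lookup q (lead_mono q) / Poly_Mapping.lookup p (lead_mono p)) * p"
  shows "r = 0 \<or> lead_mono r < lead_mono q"
proof (cases "r = 0")
  case False
  let ?c = "Poly_Mapping.lookup q (lead_mono q) / Poly_Mapping.lookup p (lead_mono p)"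
  have "Poly_Mapping.lookup r (lead_mono q) = 0"
    using lead_mono_in_keys[OF p] unfolding r_def lookup_minus
    by (subst (3) d) (simp add: lookup_single_mult in_keys_iff)
  moreover have "m \<le> lead_mono q" if "m \<in> Poly_Mapping.keys r" for m
  proof -
    have "m \<in> Poly_Mapping.keys q \<or> m \<in> Poly_Mapping.keys (Poly_Mapping.single d ?c * p)"
      using that by (auto simp: r_def in_keys_iff lookup_minus)
    then show ?thesis
    proof
      assume "m \<in> Poly_Mapping.keys (Poly_Mapping.single d ?c * p)"
      then obtain k where k: "m = d + k" "k \<in> Poly_Mapping.keys p"
        using keys_mult[of "Poly_Mapping.single d ?c" p] by (fastforce split: if_splits)
      then have "k \<le> lead_mono p" by (simp add: lead_mono_def)
      then show ?thesis using k(1) d by (simp add: add_left_mono)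
    qed (simp add: lead_mono_def)
  qed
  ultimately show ?thesis
    using lead_mono_in_keys[OF False] by (metis in_keys_iff order_le_imp_less_or_eq)
qed simp

text \<open>The elements of least leading monomial that are new at each step of a strictly
  ascending chain would contradict Dickson's lemma.\<close>

lemma ideal_chain_stops:
  assumes I: "\<And>k. is_ideal n (I k)" and mono: "\<And>k. I k \<subseteq> I (Suc k)"
  shows "\<exists>k. I (Suc k) \<subseteq> I k"
proof (rule ccontr)
  assume neg: "\<not> ?thesis"
  let ?R = "{(x, y). x < y \<and> Poly_Mapping.keys x \<subseteq> {..<n} \<and> Poly_Mapping.keys y \<subseteq> {..<n}}"
  have keys: "Poly_Mapping.keys (lead_mono q) \<subseteq> {..<n}" if "q \<in> I (Suc k) - I k" for q k
    using that lead_mono_in_keys[of q] ideal_zero[OF I] ideal_subset[OF I[of "Suc k"], of q]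
    by (auto simp: Apoly_def)
  have "\<exists>p\<in>I (Suc k) - I k. \<forall>q\<in>I (Suc k) - I k. \<not> lead_mono q < lead_mono p" for k
  proof -
    obtain p0 where "p0 \<in> I (Suc k) - I k" using neg by blast
    then obtain m where m: "m \<in> lead_mono ` (I (Suc k) - I k)"
      "\<And>y. (y, m) \<in> ?R \<Longrightarrow> y \<notin> lead_mono ` (I (Suc k) - I k)"
      using wfE_min[OF wf_monomials[of n], of "lead_mono p0" "lead_mono ` (I (Suc k) - I k)"] by blast
    from m(1) obtain p where p: "m = lead_mono p" "p \<in> I (Suc k) - I k" by blast
    have "\<not> lead_mono q < lead_mono p" if "q \<in> I (Suc k) - I k" for q
      using m(2)[of "lead_mono q"] that keys[OF that] keys[OF p(2)] p(1) by auto
    with p show ?thesis by blast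
  qed
  then obtain p where p: "\<And>k. p k \<in> I (Suc k)" "\<And>k. p k \<notin> I k"
    "\<And>k q. q \<in> I (Suc k) - I k \<Longrightarrow> \<not> lead_mono q < lead_mono (p k)"
    by (metis DiffE)
  have "Poly_Mapping.keys (lead_mono (p k)) \<subseteq> {..<n}" for k
    using p keys by blast
  then obtain i j d where ij: "i < j" "lead_mono (p j) = d + lead_mono (p i)"
    using dickson[of "\<lambda>k. lead_mono (p k)" n] by blast
  have nz: "p k \<noteq> 0" for k using p(2) ideal_zero[OF I] by metis
  define c where "c = Poly_Mapping.lookup (p j) (lead_mono (p j)) / Poly_Mapping.lookup (p i) (lead_mono (p i))"
  \<comment> \<open>Subtracting a multiple of the earlier \<open>p i\<close> does not leave the
    layer between \<open>I j\<close> and \<open>I (Suc j)\<close>, yet it lowers the leading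
    monomial, against the choice of \<open>p j\<close>.\<close>
  define r where "r = p j - Poly_Mapping.single d c * p i"
  have "Poly_Mapping.keys d \<subseteq> Poly_Mapping.keys (lead_mono (p j))"
    using ij(2) by (auto simp: in_keys_iff lookup_add)
  then have sd: "Poly_Mapping.single d c \<in> Apoly n"
    using \<open>\<And>k. Poly_Mapping.keys (lead_mono (p k)) \<subseteq> {..<n}\<close>[of j] by (auto simp: Apoly_def)
  have "I (Suc i) \<subseteq> I j"
    using lift_Suc_mono_le[of I, OF mono] ij(1) by auto
  then have m: "Poly_Mapping.single d c * p i \<in> I j"
    using ideal_mult[OF I _ sd] p(1)[of i] by blast
  then have "r \<in> I (Suc j)"
    unfolding r_def using p(1) mono by (intro ideal_diff[OF I]) auto
  moreover have "r \<notin> I j"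
    using ideal_add[OF I _ m, of r] p(2)[of j] by (auto simp: r_def)
  moreover have "r = 0 \<or> lead_mono r < lead_mono (p j)"
    unfolding r_def c_def by (rule lead_reduce[OF nz nz ij(2)])
  ultimately show False
    using p(3)[of r j] ideal_zero[OF I] by blast
qed

section \<open>Products and powers of ideals\<close>

inductive_set iprod :: "mpoly set \<Rightarrow> mpoly set \<Rightarrow> mpoly set" for I J where
  iprod_zero: "0 \<in> iprod I J"
| iprod_step: "a \<in> I \<Longrightarrow> b \<in> J \<Longrightarrow> c \<in> iprod I J \<Longrightarrow> a * b + c \<in> iprod I J"

lemma iprodI: "a \<in> I \<Longrightarrow> b \<in> J \<Longrightarrow> a * b \<in> iprod I J"
  using iprod_step[OF _ _ iprod_zero] by fastforce

lemma iprod_ideal: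
  assumes I: "is_ideal n I" and J: "is_ideal n J"
  shows "is_ideal n (iprod I J)"
  unfolding is_ideal_def
proof (intro conjI ballI)
  show "iprod I J \<subseteq> Apoly n"
  proof
    show "x \<in> Apoly n" if "x \<in> iprod I J" for x
      using that by induction (use ideal_subset[OF I] ideal_subset[OF J] in auto)
  qed
  show "0 \<in> iprod I J" by (rule iprod_zero)
  show "x + y \<in> iprod I J" if "x \<in> iprod I J" "y \<in> iprod I J" for x y
    using that by induction (auto simp: add.assoc intro: iprod_step)
  show "r * x \<in> iprod I J" if "x \<in> iprod I J" "r \<in> Apoly n" for x r
    using that
  proof induction
    case (iprod_step a b c)
    then show ?case
      using iprod.iprod_step[of "r * a" I b J "r * c"] ideal_mult[OF I] by (simp add: algebra_simps)
  qed (simp add: iprod_zero)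
qed

lemma iprod_least:
  assumes "is_ideal n K" "\<And>a b. a \<in> I \<Longrightarrow> b \<in> J \<Longrightarrow> a * b \<in> K"
  shows "iprod I J \<subseteq> K"
proof
  show "x \<in> K" if "x \<in> iprod I J" for x
    using that by induction (auto intro: ideal_zero[OF assms(1)] ideal_add[OF assms(1)] assms(2))
qed

primrec ipow :: "nat \<Rightarrow> mpoly set \<Rightarrow> nat \<Rightarrow> mpoly set" where
  "ipow n I 0 = Apoly n"
| "ipow n I (Suc k) = iprod I (ipow n I k)"

lemma Apoly_ideal [simp]: "is_ideal n (Apoly n)"
  by (simp add: is_ideal_def)

lemma ipow_ideal: "is_ideal n I \<Longrightarrow> is_ideal n (ipow n I k)"
  by (induction k) (simp_all add: iprod_ideal)

lemma ipow_Suc_subset: "is_ideal n I \<Longrightarrow> ipow n I (Suc k) \<subseteq> ipow n I k"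
  by (simp, rule iprod_least[OF ipow_ideal]) (auto intro: ideal_mult[OF ipow_ideal] ideal_subset)

lemma ipow_one: "is_ideal n I \<Longrightarrow> ipow n I 1 = I"
proof
  assume I: "is_ideal n I"
  show "ipow n I 1 \<subseteq> I"
    by simp (rule iprod_least[OF I], auto intro: ideal_mult_right[OF I])
  show "I \<subseteq> ipow n I 1"
    using iprodI[of _ I 1 "Apoly n"] by fastforce
qed

text \<open>A binomial expansion for ideals. Peeling off one factor \<open>b + r * y\<close>, the
  part \<open>b\<close> calls for the induction hypothesis with \<open>N\<close> lowered by 1, and
  the part \<open>r * y\<close> for the one with \<open>j\<close> lowered by 1.\<close>

lemma ipow_isum_principal:
  assumes B: "is_ideal n B" and y: "y \<in> Apoly n"
  shows "ipow n (isum B (principal n y)) (N + j) \<subseteq> isum (ipow n B N) (principal n (y ^ j))"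
proof (induction "N + j" arbitrary: N j)
  case (Suc k)
  let ?C = "isum B (principal n y)"
  have C: "is_ideal n ?C" by (rule isum_ideal[OF B principal_ideal[OF y]])
  have R: "is_ideal n (isum (ipow n B N) (principal n (y ^ j)))" for N j
    using y by (intro isum_ideal ipow_ideal B principal_ideal) simp
  consider "N = 0" | "j = 0" | N' j' where "N = Suc N'" "j = Suc j'"
    by (cases N; cases j) auto
  then show ?case
  proof cases
    case 1
    have "x \<in> isum (Apoly n) (principal n (y ^ j))" if "x \<in> Apoly n" for x
      using that y by (intro isum_left[of n] principal_ideal) auto
    with 1 show ?thesis
      using ideal_subset[OF ipow_ideal[OF C]] by auto
  next
    case 2
    have "x \<in> isum (ipow n B N) (principal n (y ^ j))" if "x \<in> Apoly n" for x
      using that principalI[of x n 1] 2 by (intro isum_right[OF ipow_ideal[OF B]]) auto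
    then show ?thesis
      using ideal_subset[OF ipow_ideal[OF C]] by auto
  next
    case 3
    have k1: "k = N' + j" "k = N + j'" using Suc(2) 3 by auto
    show ?thesis
      unfolding Suc(2)[symmetric] ipow.simps
    proof (rule iprod_least[OF R])
      fix c g assume c: "c \<in> ?C" and g: "g \<in> ipow n ?C k"
      from c obtain b r where br: "c = b + r * y" "b \<in> B" "r \<in> Apoly n"
        by (auto simp: isum_def principal_def)
      have gA: "g \<in> Apoly n" by (rule ideal_subset[OF ipow_ideal[OF C] g])
      from g Suc(1)[of N' j] k1(1) have "g \<in> isum (ipow n B N') (principal n (y ^ j))" by auto
      then obtain g1 r1 where g1: "g = g1 + r1 * y ^ j" "g1 \<in> ipow n B N'" "r1 \<in> Apoly n"
        by (auto simp: isum_def principal_def)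
      from g Suc(1)[of N j'] k1(2) have "g \<in> isum (ipow n B N) (principal n (y ^ j'))" by auto
      then obtain g2 r2 where g2: "g = g2 + r2 * y ^ j'" "g2 \<in> ipow n B N" "r2 \<in> Apoly n"
        by (auto simp: isum_def principal_def)
      have bA: "b \<in> Apoly n" by (rule ideal_subset[OF B br(2)])
      have "c * g = (b * g1 + r * y * g2) + (b * r1 + r * r2) * y ^ j"
        unfolding br(1) distrib_right
        by (subst (1) g1(1), subst (1) g2(1)) (simp add: 3 algebra_simps)
      moreover have "b * g1 \<in> ipow n B N"
        using br(2) g1(2) 3 by (simp add: iprodI)
      moreover have "r * y * g2 \<in> ipow n B N"
        using br(3) y g2(2) by (intro ideal_mult[OF ipow_ideal[OF B]]) auto
      ultimately show "c * g \<in> isum (ipow n B N) (principal n (y ^ j))"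
        using bA br(3) g1(3) g2(3)
        by (auto intro!: isumI principalI ideal_add[OF ipow_ideal[OF B]])
    qed
  qed
next
  case 0
  have "x \<in> isum (Apoly n) (principal n 1)" if "x \<in> Apoly n" for x
    using that by (intro isum_left[of n] principal_ideal) auto
  with 0 show ?case
    using ideal_subset[OF ipow_ideal[OF isum_ideal[OF B principal_ideal[OF y]]]] by auto
qed

section \<open>Ideals given by finitely many generators\<close>

primrec gens :: "nat \<Rightarrow> (nat \<Rightarrow> mpoly) \<Rightarrow> nat \<Rightarrow> mpoly set" where
  "gens n y 0 = {0}"
| "gens n y (Suc r) = isum (gens n y r) (principal n (y r))"

lemma gens_ideal: "(\<And>i. i < r \<Longrightarrow> y i \<in> Apoly n) \<Longrightarrow> is_ideal n (gens n y r)"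
proof (induction r)
  case 0
  then show ?case by (simp add: is_ideal_def)
qed (simp add: isum_ideal principal_ideal)

lemma gens_mem: "(\<And>i. i < r \<Longrightarrow> y i \<in> Apoly n) \<Longrightarrow> i < r \<Longrightarrow> y i \<in> gens n y r"
proof (induction r)
  case (Suc r)
  then show ?case
    using isum_left[OF principal_ideal[of "y r" n], of "y i" "gens n y r"]
      isum_right[OF gens_ideal[of r y n] principal_self[of "y r" n]]
    by (cases "i = r") auto
qed simp

lemma gens_least: "is_ideal n I \<Longrightarrow> (\<And>i. i < r \<Longrightarrow> y i \<in> I) \<Longrightarrow> gens n y r \<subseteq> I"
  by (induction r) (auto simp: isum_def principal_def intro!: ideal_add ideal_mult ideal_zero)

text \<open>The generators enter one at a time through \<open>ipow_isum_principal\<close>, so the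
  exponents simply add up.\<close>

lemma gens_nilpotent:
  assumes K: "is_ideal n K" and y: "\<And>i. i < r \<Longrightarrow> y i \<in> Apoly n" "\<And>i. i < r \<Longrightarrow> \<exists>j. y i ^ j \<in> K"
  shows "\<exists>N. ipow n (gens n y r) N \<subseteq> K"
  using y
proof (induction r)
  case 0
  have "ipow n {0} 1 \<subseteq> K"
    by simp (rule iprod_least[OF K], simp add: ideal_zero[OF K])
  then show ?case by (metis gens.simps(1))
next
  case (Suc r)
  then obtain N where N: "ipow n (gens n y r) N \<subseteq> K" by auto
  obtain j where "y r ^ j \<in> K" using Suc.prems(2) by blast
  note Nj = N this
  have "isum (ipow n (gens n y r) N) (principal n (y r ^ j)) \<subseteq> K"
    using Nj by (auto simp: isum_def principal_def intro!: ideal_add[OF K] ideal_mult[OF K])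
  then show ?case
    using ipow_isum_principal[of n "gens n y r" "y r" N j] gens_ideal[of r y n] Suc.prems(1)
    by (intro exI[of _ "N + j"]) auto
qed

text \<open>Modulo the linear polynomials \<open>y i\<close> every polynomial is congruent to a
  constant, and the only constant in \<open>M\<close> is 0. Thus \<open>M\<close> is the ideal of a
  point and the \<open>y i\<close> are the coordinates centred there.\<close>

lemma maximal_generators:
  assumes M: "is_maximal_ideal n M"
  obtains y where "\<And>i. i < n \<Longrightarrow> y i \<in> M" "\<And>i. i < n \<Longrightarrow> \<exists>c. y i = var i - const c" "M = gens n y n"
proof -
  have I: "is_ideal n M" "M \<noteq> Apoly n" using M by (auto simp: is_maximal_ideal_def)
  have "\<forall>i. \<exists>c. i < n \<longrightarrow> var i - const c \<in> M"
    using maximal_residue_const[OF M Apoly_var] by blast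
  then obtain c where c: "\<And>i. i < n \<Longrightarrow> var i - const (c i) \<in> M" by metis
  define y where "y i = var i - const (c i)" for i
  have yA: "y i \<in> Apoly n" if "i < n" for i using that by (simp add: y_def)
  have G: "is_ideal n (gens n y n)" by (rule gens_ideal[OF yA])
  have "\<exists>d. h - const d \<in> gens n y n" if "h \<in> Apoly n" for h
    using that
  proof (induction h rule: Apoly_induct)
    case (const d)
    then show ?case using ideal_zero[OF G] by (intro exI[of _ d]) simp
  next
    case (var i)
    then have "var i - const (c i) \<in> gens n y n"
      using gens_mem[of n y n i] yA unfolding y_def by blast
    then show ?case by blast
  next
    case (add a b)
    then obtain d e where "a - const d \<in> gens n y n" "b - const e \<in> gens n y n" by blast
    then have "(a - const d) + (b - const e) \<in> gens n y n" by (rule ideal_add[OF G])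
    then show ?case by (intro exI[of _ "d + e"]) (simp add: const_add algebra_simps)
  next
    case (mult a b)
    then obtain d e where "a - const d \<in> gens n y n" "b - const e \<in> gens n y n" by blast
    then have "b * (a - const d) + const d * (b - const e) \<in> gens n y n"
      using mult by (intro ideal_add[OF G] ideal_mult[OF G]) auto
    then show ?case by (intro exI[of _ "d * e"]) (simp add: const_mult algebra_simps)
  qed
  moreover have sub: "gens n y n \<subseteq> M"
    using c by (intro gens_least[OF I(1)]) (simp add: y_def)
  ultimately have "h \<in> gens n y n" if h: "h \<in> M" for h
  proof -
    obtain d where d: "h - const d \<in> gens n y n"
      using \<open>\<And>h. h \<in> Apoly n \<Longrightarrow> \<exists>d. h - const d \<in> gens n y n\<close> ideal_subset[OF I(1) h] by blast
    then have "const d \<in> M" using sub ideal_diff[OF I(1) h, of "h - const d"] by auto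
    then have "d = 0" by (rule const_in_ideal[OF I])
    with d show ?thesis by simp
  qed
  with sub have "M = gens n y n" by blast
  with c show thesis by (intro that[of y]) (auto simp: y_def)
qed

text \<open>A route without Artin-Rees: for T = Q + M h and L = Q + A h, the ideal \<open>T\<close>
  is enlarged to some \<open>K\<close> that contains a power of \<open>M\<close> and still satisfies
  \<open>K \<inter> L \<subseteq> T\<close>. Then \<open>h\<close> lies in both \<open>K\<close> and
  \<open>L\<close>, hence in \<open>T\<close>.\<close>

lemma krull_intersection:
  assumes M: "is_maximal_ideal n M" and Q: "is_ideal n Q"
    and h: "h \<in> Apoly n" "\<And>k. h \<in> isum Q (ipow n M k)"
  shows "\<exists>m\<in>M. h - m * h \<in> Q"
proof -
  have I: "is_ideal n M" using M by (simp add: is_maximal_ideal_def)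
  obtain y where y: "\<And>i. i < n \<Longrightarrow> y i \<in> M" "M = gens n y n"
    using maximal_generators[OF M] by metis
  have yA: "y i \<in> Apoly n" if "i < n" for i by (rule ideal_subset[OF I y(1)[OF that]])
  define T where "T = {x \<in> Apoly n. \<exists>m\<in>M. x - m * h \<in> Q}"
  define L where "L = isum Q (principal n h)"
  have T: "is_ideal n T"
    unfolding is_ideal_def
  proof (intro conjI ballI)
    show "0 \<in> T"
      using ideal_zero[OF I] ideal_zero[OF Q] by (auto simp: T_def intro!: bexI[of _ 0])
    fix a assume "a \<in> T"
    then obtain m where m: "a \<in> Apoly n" "m \<in> M" "a - m * h \<in> Q" by (auto simp: T_def)
    show "a + b \<in> T" if "b \<in> T" for b
    proof -
      from that obtain k where k: "b \<in> Apoly n" "k \<in> M" "b - k * h \<in> Q" by (auto simp: T_def)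
      have "(a + b) - (m + k) * h = (a - m * h) + (b - k * h)" by (simp add: algebra_simps)
      then have "(a + b) - (m + k) * h \<in> Q"
        using ideal_add[OF Q m(3) k(3)] by metis
      then show ?thesis
        using m(1) k(1) ideal_add[OF I m(2) k(2)] by (auto simp: T_def)
    qed
    show "r * a \<in> T" if "r \<in> Apoly n" for r
    proof -
      have "r * a - (r * m) * h = r * (a - m * h)" by (simp add: algebra_simps)
      then have "r * a - (r * m) * h \<in> Q"
        using ideal_mult[OF Q m(3) that] by metis
      then show ?thesis
        using m(1) that ideal_mult[OF I m(2) that] by (auto simp: T_def)
    qed
  qed (auto simp: T_def)
  \<comment> \<open>The generators of \<open>M\<close> are treated one at a time: \<open>K\<close>
    absorbs a power of each without meeting \<open>L\<close> outside \<open>T\<close>.\<close>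
  have "\<exists>K. is_ideal n K \<and> T \<subseteq> K \<and> K \<inter> L \<subseteq> T \<and> (\<forall>i<r. \<exists>j. y i ^ j \<in> K)" if "r \<le> n" for r
    using that
  proof (induction r)
    case 0
    then show ?case using T by (intro exI[of _ T]) auto
  next
    case (Suc r)
    then obtain K where K: "is_ideal n K" "T \<subseteq> K" "K \<inter> L \<subseteq> T" "\<forall>i<r. \<exists>j. y i ^ j \<in> K" by auto
    have yr: "y r \<in> Apoly n" "y r \<in> M" using Suc.prems yA y(1) by auto
    \<comment> \<open>The colon ideals of \<open>K\<close> by powers of \<open>y r\<close> ascend.
      Where their chain stalls, at \<open>j\<close>, the power \<open>y r ^ j\<close> can safely be
      added to \<open>K\<close>.\<close>
    let ?C = "\<lambda>j. {x \<in> Apoly n. y r ^ j * x \<in> K}"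
    have "is_ideal n (?C j)" for j
      unfolding is_ideal_def
    proof (intro conjI ballI)
      fix a assume a: "a \<in> ?C j"
      show "a + b \<in> ?C j" if "b \<in> ?C j" for b
        using a that ideal_add[OF K(1)] by (auto simp: distrib_left)
      show "x * a \<in> ?C j" if "x \<in> Apoly n" for x
        using a that ideal_mult[OF K(1), of "y r ^ j * a" x] by (auto simp: mult.left_commute)
    qed (auto simp: ideal_zero[OF K(1)])
    moreover have "?C j \<subseteq> ?C (Suc j)" for j
      using ideal_mult[OF K(1), of _ "y r"] yr(1) by (auto simp: mult.assoc)
    ultimately obtain j where j: "?C (Suc j) \<subseteq> ?C j"
      using ideal_chain_stops[of n ?C] by blast
    let ?K = "isum K (principal n (y r ^ j))"
    have pr: "is_ideal n (principal n (y r ^ j))" using yr by (intro principal_ideal) auto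
    have "?K \<inter> L \<subseteq> T"
    proof
      fix z assume z: "z \<in> ?K \<inter> L"
      then obtain a x where a: "a \<in> K" "x \<in> Apoly n" "z = a + x * y r ^ j"
        by (auto simp: isum_def principal_def)
      from z obtain s where s: "s \<in> Apoly n" "z - s * h \<in> Q"
        by (auto simp: L_def mem_isum_principal)
      have zA: "z \<in> Apoly n" using a ideal_subset[OF K(1)] yr(1) by auto
      \<comment> \<open>Multiplication by \<open>y r\<close> sends \<open>L\<close> into
        \<open>T\<close>, since \<open>y r\<close> lies in \<open>M\<close>. Hence
        \<open>x * y r ^ Suc j\<close> lies in \<open>K\<close>, and by the choice of
        \<open>j\<close> so does \<open>x * y r ^ j\<close>.\<close>
      have "y r * z - (s * y r) * h = y r * (z - s * h)" by (simp add: algebra_simps)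
      then have "y r * z \<in> T"
        using zA yr s ideal_mult[OF Q s(2) yr(1)] ideal_mult[OF I yr(2) s(1)]
        by (auto simp: T_def intro!: bexI[of _ "s * y r"])
      then have "y r * z - y r * a \<in> K"
        using K(2) by (intro ideal_diff[OF K(1)] ideal_mult[OF K(1) a(1) yr(1)]) auto
      then have "x \<in> ?C (Suc j)"
        using a by (simp add: algebra_simps)
      then have "x \<in> ?C j" using j by blast
      then have "z \<in> K"
        using a ideal_add[OF K(1)] by (simp add: mult.commute)
      then show "z \<in> T" using z K(3) by blast
    qed
    moreover have "K \<subseteq> ?K" using isum_left[OF pr] by blast
    moreover have "y r ^ j \<in> ?K" by (rule isum_right[OF K(1) principal_self])
    ultimately have "\<exists>j. y i ^ j \<in> ?K" if "i < Suc r" for i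
      using that K(4) by (cases "i = r") (blast, auto simp: less_Suc_eq dest!: spec[of _ i] subsetD[OF \<open>K \<subseteq> ?K\<close>])
    with \<open>?K \<inter> L \<subseteq> T\<close> \<open>K \<subseteq> ?K\<close> show ?case
      using K(2) isum_ideal[OF K(1) pr] by (intro exI[of _ ?K]) auto
  qed
  then obtain K where K: "is_ideal n K" "T \<subseteq> K" "K \<inter> L \<subseteq> T" "\<forall>i<n. \<exists>j. y i ^ j \<in> K" by blast
  obtain N where "ipow n M N \<subseteq> K"
    using gens_nilpotent[OF K(1), of n y] yA K(4) y(2) by auto
  moreover have "Q \<subseteq> K"
  proof
    show "x \<in> K" if "x \<in> Q" for x
      using that K(2) ideal_subset[OF Q] ideal_zero[OF I] by (auto simp: T_def intro!: bexI[of _ 0])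
  qed
  ultimately have "h \<in> K"
    using h(2)[of N] ideal_add[OF K(1)] by (auto simp: isum_def)
  moreover have "h \<in> L"
    unfolding L_def by (rule isum_right[OF Q principal_self])
  ultimately show ?thesis
    using K(3) by (auto simp: T_def)
qed

section \<open>The Jacobian Poisson bracket and Poisson cores\<close>

lemma derivation_funpow_mult:
  fixes D :: "'a::comm_ring_1 \<Rightarrow> 'a"
  assumes add: "\<And>x y. D (x + y) = D x + D y" and mult: "\<And>x y. D (x * y) = x * D y + y * D x"
  shows "(D ^^ m) (a * b) = (\<Sum>i\<le>m. of_nat (m choose i) * ((D ^^ i) a * (D ^^ (m - i)) b))"
proof (induction m)
  case (Suc m)
  let ?F = "\<lambda>i j. (D ^^ i) a * (D ^^ j) b"
  have D0: "D 0 = 0" using add[of 0 0] by simp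
  have sum: "D (sum f S) = (\<Sum>x\<in>S. D (f x))" for f :: "nat \<Rightarrow> 'a" and S
    by (induction S rule: infinite_finite_induct) (simp_all add: add D0)
  have D1: "D 1 = 0" using mult[of 1 1] by simp
  have Dnat: "D (of_nat k * x) = of_nat k * D x" for k x
    by (induction k) (simp_all add: D0 add distrib_right)
  have "(D ^^ Suc m) (a * b) = (\<Sum>i\<le>m. of_nat (m choose i) * D (?F i (m - i)))"
    by (simp add: Suc sum Dnat)
  also have "\<dots> = (\<Sum>i\<le>m. of_nat (m choose i) * ?F (Suc i) (m - i))
      + (\<Sum>i\<le>m. of_nat (m choose i) * ?F i (Suc m - i))"
    by (auto simp: mult sum.distrib[symmetric] distrib_left ac_simps Suc_diff_le intro!: sum.cong)
  also have "(\<Sum>i\<le>m. of_nat (m choose i) * ?F i (Suc m - i))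
      = (\<Sum>i\<le>Suc m. of_nat (m choose i) * ?F i (Suc m - i))"
    by (simp add: binomial_eq_0)
  also have "\<dots> = ?F 0 (Suc m) + (\<Sum>i\<le>m. of_nat (m choose Suc i) * ?F (Suc i) (m - i))"
    by (subst sum.atMost_Suc_shift) simp
  also have "(\<Sum>i\<le>m. of_nat (m choose i) * ?F (Suc i) (m - i)) + \<dots>
      = ?F 0 (Suc m) + (\<Sum>i\<le>m. of_nat (Suc m choose Suc i) * ?F (Suc i) (Suc m - Suc i))"
    by (simp add: sum.distrib[symmetric] distrib_right)
  also have "\<dots> = (\<Sum>i\<le>Suc m. of_nat (Suc m choose i) * ?F i (Suc m - i))"
    by (subst sum.atMost_Suc_shift) simp
  finally show ?case .
qed simp

locale jacobian_poisson =
  fixes n :: nat and s t :: "nat \<Rightarrow> mpoly"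
  assumes n3: "n \<ge> 3"
    and s_Apoly: "\<And>i. i < n - 2 \<Longrightarrow> s i \<in> Apoly n"
    and t_Apoly: "\<And>i. i < n - 2 \<Longrightarrow> t i \<in> Apoly n"
begin

text \<open>For \<open>r \<ge> 2\<close> this row is t^2 times the gradient of s/t at index
  \<open>r - 2\<close>. Rows 0 and 1 are placeholders, overwritten by the gradients of the two
  arguments of the bracket.\<close>

definition W :: "nat \<Rightarrow> nat \<Rightarrow> mpoly" where
  "W r j = t (r - 2) * pd j (s (r - 2)) - s (r - 2) * pd j (t (r - 2))"

abbreviation br :: "mpoly \<Rightarrow> mpoly \<Rightarrow> mpoly" where
  "br \<equiv> pb n s t"

lemma br_eq: "br f g = detn n (W(0 := (\<lambda>j. pd j f), 1 := (\<lambda>j. pd j g)))"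
  unfolding pb_def by (rule detn_cong) (simp add: W_def)

text \<open>The row lemmas match the outermost update of a matrix: this form exposes row 0, while
  \<open>br_eq\<close> exposes row 1.\<close>

lemma br_eq': "br f g = detn n (W(1 := (\<lambda>j. pd j g), 0 := (\<lambda>j. pd j f)))"
  unfolding br_eq by (subst fun_upd_twist) simp_all

lemma W_Apoly: "2 \<le> r \<Longrightarrow> r < n \<Longrightarrow> W r j \<in> Apoly n"
  by (auto simp: W_def s_Apoly t_Apoly)

lemma br_Apoly [simp]: "a \<in> Apoly n \<Longrightarrow> b \<in> Apoly n \<Longrightarrow> br a b \<in> Apoly n"
  unfolding br_eq by (rule detn_Apoly) (auto intro: W_Apoly)

lemma br_add_left: "br (a + b) g = br a g + br b g"
  unfolding br_eq' pd_add using n3 by (simp add: detn_row_add)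

lemma br_mult_left: "br (a * b) g = a * br b g + b * br a g"
proof -
  have "(\<lambda>j. pd j (a * b)) = (\<lambda>j. a * pd j b + b * pd j a)"
    by (simp add: pd_mult algebra_simps)
  then show ?thesis
    unfolding br_eq' using n3 by (simp add: detn_row_add detn_row_scale)
qed

lemma br_self: "br a a = 0"
  unfolding br_eq using n3 by (intro detn_identical_rows[of 0 1]) auto

lemma br_add_right: "br g (a + b) = br g a + br g b"
  unfolding br_eq pd_add using n3 by (simp add: detn_row_add)

lemma br_swap: "br a b = - br b a"
proof -
  have "br (a + b) (a + b) = (br a a + br a b) + (br b a + br b b)"
    by (simp add: br_add_left br_add_right)
  then show ?thesis by (simp add: br_self eq_neg_iff_add_eq_0)
qed

lemma br_const_left [simp]: "br (const c) g = 0"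
  using br_mult_left[of "const c" 1 g] br_mult_left[of 1 1 g] detn_row_scale[of 0 n "W(1 := \<lambda>j. pd j g)" 0 "\<lambda>_. 0"] n3
  unfolding br_eq' by simp

lemma br_one_left [simp]: "br 1 g = 0"
  using br_const_left[of 1 g] by simp

lemma br_zero_left [simp]: "br 0 g = 0"
  using br_const_left[of 0 g] by simp

lemma br_const_right [simp]: "br g (const c) = 0"
  by (subst br_swap) simp

lemma br_one_right [simp]: "br g 1 = 0"
  by (subst br_swap) simp

lemma br_uminus_left: "br (- a) g = - br a g"
  using br_add_left[of a "- a" g] by (simp add: eq_neg_iff_add_eq_0 add.commute)

lemma br_diff_left: "br (a - b) g = br a g - br b g"
  using br_add_left[of a "- b" g] by (simp add: br_uminus_left)

lemma br_diff_right: "br g (a - b) = br g a - br g b"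
  by (subst (1 2 3) br_swap) (simp add: br_diff_left)

lemma br_const_mult_left: "br (const c * a) g = const c * br a g"
  by (simp add: br_mult_left)

lemma br_mult_right: "br g (a * b) = a * br g b + b * br g a"
  by (subst (1 2 3) br_swap) (simp add: br_mult_left)

lemma br_row_zero:
  assumes "i < n - 2" "\<And>j. v j = W (i + 2) j"
  shows "detn n (W(1 := (\<lambda>j. pd j g), 0 := v)) = 0"
  using assms by (intro detn_identical_rows[of 0 "i + 2"]) (auto intro!: ext)

text \<open>This is {s i / t i, g} = 0 with the denominator cleared: the combination of gradients in
  row 0 repeats row \<open>i + 2\<close>.\<close>

lemma casimir: "i < n - 2 \<Longrightarrow> t i * br (s i) g = s i * br (t i) g"
proof -
  assume i: "i < n - 2"
  have "t i * br (s i) g + (- s i) * br (t i) g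
      = detn n (W(1 := (\<lambda>j. pd j g), 0 := (\<lambda>j. t i * pd j (s i) + (- s i) * pd j (t i))))"
    unfolding br_eq' using n3 by (simp add: detn_row_add detn_row_scale del: mult_minus_left)
  also have "\<dots> = 0"
    by (rule br_row_zero[OF i]) (simp add: W_def)
  finally show ?thesis by simp
qed

text \<open>Every term of the determinant has a factor from row \<open>r\<close>. This will exclude
  that \<open>s i\<close> and \<open>t i\<close> both lie in a prime that is not residually
  null.\<close>

lemma br_member_if_row_member:
  assumes P: "is_ideal n P" and r: "2 \<le> r" "r < n" and W: "\<And>j. W r j \<in> P"
    and ab: "a \<in> Apoly n" "b \<in> Apoly n"
  shows "br a b \<in> P"
proof -
  let ?M = "W(0 := (\<lambda>j. pd j a), 1 := (\<lambda>j. pd j b))"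
  have M: "?M i j \<in> Apoly n" if "i < n" for i j
    using that ab by (auto intro: W_Apoly)
  have "br a b = detn n (?M(r := W r))"
    using r by (simp add: br_eq fun_upd_idem)
  also have "\<dots> \<in> P"
    unfolding detn_split_row[OF r(2)] mult.commute[of "W r _"]
    using W by (intro ideal_sum[OF P] ideal_mult[OF P] Apoly_mult Apoly_of_int Apoly_prod M) auto
  finally show ?thesis .
qed

section \<open>Poisson ideals and Poisson cores\<close>

lemma poisson_ideal: "is_poisson_ideal n s t I \<Longrightarrow> is_ideal n I"
  by (simp add: is_poisson_ideal_def)

lemma poisson_br: "is_poisson_ideal n s t I \<Longrightarrow> a \<in> I \<Longrightarrow> b \<in> Apoly n \<Longrightarrow> br a b \<in> I"
  by (simp add: is_poisson_ideal_def)

lemma poisson_br_right: "is_poisson_ideal n s t I \<Longrightarrow> a \<in> I \<Longrightarrow> b \<in> Apoly n \<Longrightarrow> br b a \<in> I"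
  by (subst br_swap) (auto intro: ideal_uminus poisson_ideal poisson_br)

lemma isum_poisson:
  assumes I: "is_poisson_ideal n s t I" and J: "is_poisson_ideal n s t J"
  shows "is_poisson_ideal n s t (isum I J)"
  unfolding is_poisson_ideal_def
proof (intro conjI ballI)
  show "is_ideal n (isum I J)" by (rule isum_ideal[OF poisson_ideal[OF I] poisson_ideal[OF J]])
  show "br x g \<in> isum I J" if x: "x \<in> isum I J" and g: "g \<in> Apoly n" for x g
  proof -
    from x obtain a b where "x = a + b" "a \<in> I" "b \<in> J" by (auto simp: isum_def)
    then show ?thesis
      using poisson_br[OF I _ g] poisson_br[OF J _ g] by (auto simp: br_add_left intro: isumI)
  qed
qed

text \<open>The definite description denotes something because the union is itself a Poisson ideal:
  two Poisson ideals inside \<open>J\<close> lie in their sum, which is again one inside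
  \<open>J\<close>.\<close>

lemma poisson_core_eq:
  assumes J: "is_ideal n J"
  shows "poisson_core n s t J = \<Union>{I. is_poisson_ideal n s t I \<and> I \<subseteq> J}"
    and "is_poisson_ideal n s t (poisson_core n s t J)"
proof -
  have zero: "is_poisson_ideal n s t {0}"
    by (simp add: is_poisson_ideal_def is_ideal_def)
  define U where "U = \<Union>{I. is_poisson_ideal n s t I \<and> I \<subseteq> J}"
  have mem: "x \<in> U \<longleftrightarrow> (\<exists>I. is_poisson_ideal n s t I \<and> I \<subseteq> J \<and> x \<in> I)" for x
    by (auto simp: U_def)
  have "is_poisson_ideal n s t U"
    unfolding is_poisson_ideal_def is_ideal_def
  proof (intro conjI ballI)
    show "0 \<in> U" unfolding mem using zero ideal_zero[OF J] by blast
    fix a assume "a \<in> U"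
    then obtain I where I: "is_poisson_ideal n s t I" "I \<subseteq> J" "a \<in> I" unfolding mem by blast
    show "a + b \<in> U" if b: "b \<in> U" for b
    proof -
      from b obtain K where K: "is_poisson_ideal n s t K" "K \<subseteq> J" "b \<in> K" unfolding mem by blast
      have "isum I K \<subseteq> J"
        using I(2) K(2) ideal_add[OF J] by (auto simp: isum_def)
      then show ?thesis
        unfolding mem using isum_poisson[OF I(1) K(1)] isumI[OF I(3) K(3)] by blast
    qed
    show "r * a \<in> U" if "r \<in> Apoly n" for r
      unfolding mem using I ideal_mult[OF poisson_ideal[OF I(1)] I(3) that] by blast
    show "br a g \<in> U" if "g \<in> Apoly n" for g
      unfolding mem using I poisson_br[OF I(1) I(3) that] by blast
  qed (use ideal_subset[OF J] mem in blast)
  moreover from this have "poisson_core n s t J = U"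
    unfolding poisson_core_def using U_def
    by (intro the_equality conjI allI impI subset_antisym) (auto simp: mem)
  ultimately show "poisson_core n s t J = \<Union>{I. is_poisson_ideal n s t I \<and> I \<subseteq> J}"
    "is_poisson_ideal n s t (poisson_core n s t J)" by (auto simp: U_def)
qed

lemma poisson_core_subset: "is_ideal n J \<Longrightarrow> poisson_core n s t J \<subseteq> J"
  by (auto simp: poisson_core_eq(1))

lemma poisson_core_greatest: "is_ideal n J \<Longrightarrow> is_poisson_ideal n s t I \<Longrightarrow> I \<subseteq> J \<Longrightarrow> I \<subseteq> poisson_core n s t J"
  by (auto simp: poisson_core_eq(1))

lemma poisson_core_id: "is_poisson_ideal n s t I \<Longrightarrow> poisson_core n s t I = I"
  using poisson_core_subset poisson_core_greatest poisson_ideal by blast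

text \<open>If D^k a and D^l b are the first iterates outside P, then D^(k+l) (a b) is congruent modulo
  P to a nonzero integer multiple of their product; this is where characteristic 0 enters.\<close>

lemma derivation_core_prime:
  assumes P: "is_prime_ideal n P" and g: "g \<in> Apoly n"
  shows "is_prime_ideal n {a \<in> Apoly n. \<forall>k. ((\<lambda>x. br x g) ^^ k) a \<in> P}" (is "is_prime_ideal n ?Q")
proof -
  define D where "D x = br x g" for x
  have D: "D (x + y) = D x + D y" "D (x * y) = x * D y + y * D x" for x y
    by (simp_all add: D_def br_add_left br_mult_left)
  have Dadd: "(D ^^ k) (x + y) = (D ^^ k) x + (D ^^ k) y" for k x y
    by (induction k) (simp_all add: D)
  have D0: "(D ^^ k) 0 = 0" for k
    by (induction k) (simp_all add: D_def)
  have DA: "(D ^^ k) x \<in> Apoly n" if "x \<in> Apoly n" for k x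
    using that g by (induction k) (simp_all add: D_def)
  have I: "is_ideal n P" by (rule prime_ideal[OF P])
  have Q: "?Q = {a \<in> Apoly n. \<forall>k. (D ^^ k) a \<in> P}"
    by (simp add: D_def[abs_def])
  have ideal: "is_ideal n ?Q"
    unfolding Q is_ideal_def
    by (auto simp: Dadd D0 ideal_zero[OF I] derivation_funpow_mult[of D, OF D] DA
        intro!: ideal_add[OF I] ideal_sum[OF I] ideal_mult[OF I])
  show ?thesis
    unfolding is_prime_ideal_def
  proof (intro conjI ballI impI ideal)
    show "?Q \<noteq> Apoly n"
    proof
      assume "?Q = Apoly n"
      then have "1 \<in> ?Q" by simp
      then have "(D ^^ 0) 1 \<in> P" unfolding Q by blast
      then show False using prime_one[OF P] by simp
    qed
    fix a b assume ab: "a \<in> Apoly n" "b \<in> Apoly n" "a * b \<in> ?Q"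
    show "a \<in> ?Q \<or> b \<in> ?Q"
    proof (rule ccontr)
      assume "\<not> ?thesis"
      then have ex: "\<exists>k. (D ^^ k) a \<notin> P" "\<exists>l. (D ^^ l) b \<notin> P"
        using ab(1,2) unfolding Q by blast+
      define k where "k = (LEAST k. (D ^^ k) a \<notin> P)"
      define l where "l = (LEAST l. (D ^^ l) b \<notin> P)"
      have k: "(D ^^ k) a \<notin> P" "\<And>i. i < k \<Longrightarrow> (D ^^ i) a \<in> P"
        unfolding k_def using LeastI_ex[OF ex(1)] not_less_Least by blast+
      have l: "(D ^^ l) b \<notin> P" "\<And>i. i < l \<Longrightarrow> (D ^^ i) b \<in> P"
        unfolding l_def using LeastI_ex[OF ex(2)] not_less_Least by blast+
      let ?T = "\<lambda>i. of_nat (k + l choose i) * ((D ^^ i) a * (D ^^ (k + l - i)) b)"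
      have "(D ^^ (k + l)) (a * b) = ?T k + (\<Sum>i\<in>{..k + l} - {k}. ?T i)"
        unfolding derivation_funpow_mult[of D, OF D] by (rule sum.remove) auto
      moreover have "(\<Sum>i\<in>{..k + l} - {k}. ?T i) \<in> P"
      proof (rule ideal_sum[OF I])
        fix i assume i: "i \<in> {..k + l} - {k}"
        then consider "i < k" | "k + l - i < l" by force
        then have "(D ^^ i) a * (D ^^ (k + l - i)) b \<in> P"
          by cases (auto intro: ideal_mult[OF I] ideal_mult_right[OF I] k l DA ab)
        then show "?T i \<in> P" by (rule ideal_mult[OF I]) simp
      qed
      moreover have "(D ^^ (k + l)) (a * b) \<in> P" using ab(3) unfolding Q by blast
      ultimately have "?T k \<in> P"
        using ideal_diff[OF I, of "(D ^^ (k + l)) (a * b)" "\<Sum>i\<in>{..k + l} - {k}. ?T i"]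
        by (simp only: add_diff_cancel_right')
      then have "const (of_nat (k + l choose k)) * ((D ^^ k) a * (D ^^ l) b) \<in> P"
        by (simp add: const_of_nat)
      then have "(D ^^ k) a * (D ^^ l) b \<in> P"
        by (rule ideal_const_mult_cancel[OF I, rotated]) simp
      then show False
        using k(1) l(1) prime_mult[OF P DA[OF ab(1)] DA[OF ab(2)]] by blast
    qed
  qed
qed

text \<open>A prime ideal that is minimal between the Poisson core of P and P is stable under every
  Hamiltonian derivation, because its core for that derivation is again prime.\<close>

lemma poisson_core_prime:
  assumes P: "is_prime_ideal n P"
  shows "is_prime_ideal n (poisson_core n s t P)"
proof -
  let ?C = "poisson_core n s t P"
  have I: "is_ideal n P" by (rule prime_ideal[OF P])
  let ?F = "{Q. is_prime_ideal n Q \<and> ?C \<subseteq> Q \<and> Q \<subseteq> P}"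
  \<comment> \<open>Zorn's lemma yields maximal elements, so a minimal prime is obtained as a
    maximal complement.\<close>
  have "\<exists>X\<in>uminus ` ?F. \<forall>Y\<in>uminus ` ?F. X \<subseteq> Y \<longrightarrow> Y = X"
  proof (rule subset_Zorn_nonempty)
    show "uminus ` ?F \<noteq> {}" using P poisson_core_subset[OF I] by blast
    fix Z assume Z: "Z \<noteq> {}" "subset.chain (uminus ` ?F) Z"
    have ch: "\<forall>X\<in>Z. \<forall>Y\<in>Z. X \<subseteq> Y \<or> Y \<subseteq> X"
      using Z(2) unfolding subset_chain_def by (rule conjunct2)
    define R where "R = - \<Union>Z"
    have mem: "- X \<in> ?F" if "X \<in> Z" for X
      using Z(2) that by (auto simp: subset.chain_def)
    have R: "x \<in> R \<longleftrightarrow> (\<forall>X\<in>Z. x \<in> - X)" for x by (auto simp: R_def)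
    have id: "is_ideal n (- X)" if "X \<in> Z" for X
      using mem[OF that] by (auto intro: prime_ideal)
    have "is_ideal n R"
      unfolding is_ideal_def
    proof (intro conjI ballI)
      obtain X0 where "X0 \<in> Z" using Z(1) by blast
      then show "R \<subseteq> Apoly n" using R ideal_subset[OF id[of X0]] by blast
      show "0 \<in> R" unfolding R by (intro ballI ideal_zero[OF id])
      show "a + b \<in> R" if "a \<in> R" "b \<in> R" for a b
        unfolding R by (intro ballI ideal_add[OF id]) (use that R in auto)
      show "r * a \<in> R" if "a \<in> R" "r \<in> Apoly n" for a r
        unfolding R by (intro ballI ideal_mult[OF id]) (use that R in auto)
    qed
    moreover have sub: "?C \<subseteq> R" "R \<subseteq> P"
    proof -
      obtain X0 where "X0 \<in> Z" using Z(1) by blast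
      then show "R \<subseteq> P" using R mem[of X0] by blast
      show "?C \<subseteq> R"
      proof
        show "x \<in> R" if "x \<in> ?C" for x
          unfolding R using that mem by blast
      qed
    qed
    moreover have "R \<noteq> Apoly n" using sub(2) prime_one[OF P] Apoly_one by blast
    moreover have "a \<in> R \<or> b \<in> R" if ab: "a \<in> Apoly n" "b \<in> Apoly n" "a * b \<in> R" for a b
    proof (rule ccontr)
      assume "\<not> ?thesis"
      then obtain X Y where XY: "X \<in> Z" "a \<notin> - X" "Y \<in> Z" "b \<notin> - Y" by (auto simp: R_def)
      then have "X \<subseteq> Y \<or> Y \<subseteq> X" using ch by blast
      \<comment> \<open>The larger of the two complements belongs to the smaller prime, which omits
        both \<open>a\<close> and \<open>b\<close>.\<close>
      then obtain V where V: "V \<in> Z" "a \<notin> - V" "b \<notin> - V" using XY by blast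
      have "a * b \<in> - V" using ab(3) V(1) unfolding R by blast
      moreover have "is_prime_ideal n (- V)" using mem[OF V(1)] by simp
      ultimately show False using V(2,3) prime_mult[OF _ ab(1,2)] by blast
    qed
    ultimately have "R \<in> ?F" by (auto simp: is_prime_ideal_def)
    moreover have "\<Union>Z = - R" by (simp add: R_def)
    ultimately show "\<Union>Z \<in> uminus ` ?F" by blast
  qed
  then obtain X where X: "X \<in> uminus ` ?F" "\<forall>Y\<in>uminus ` ?F. X \<subseteq> Y \<longrightarrow> Y = X" by (elim bexE)
  from X(1) obtain Q where Q0: "X = - Q" "Q \<in> ?F" by (elim imageE)
  have Q: "is_prime_ideal n Q" "?C \<subseteq> Q" "Q \<subseteq> P" using Q0(2) by auto
  have min: "Q' = Q" if Q': "is_prime_ideal n Q'" "?C \<subseteq> Q'" "Q' \<subseteq> Q" for Q'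
  proof -
    have "- Q' \<in> uminus ` ?F" using Q' Q(3) by (intro imageI) auto
    moreover have "X \<subseteq> - Q'" using Q'(3) Q0(1) by auto
    ultimately have "- Q' = - Q" using X(2) Q0(1) by (metis (no_types))
    then show ?thesis by simp
  qed
  have QI: "is_ideal n Q" by (rule prime_ideal[OF Q(1)])
  have "br a g \<in> Q" if a: "a \<in> Q" and g: "g \<in> Apoly n" for a g
  proof -
    let ?Q = "{a \<in> Apoly n. \<forall>k. ((\<lambda>x. br x g) ^^ k) a \<in> Q}"
    have "((\<lambda>x. br x g) ^^ k) a \<in> ?C" if "a \<in> ?C" for a k
      by (induction k) (simp_all add: that poisson_br[OF poisson_core_eq(2)[OF I] _ g])
    then have "?C \<subseteq> ?Q"
      using Q(2) ideal_subset[OF QI] by blast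
    moreover have "((\<lambda>x. br x g) ^^ 0) a \<in> Q" if "a \<in> ?Q" for a
      using that by blast
    then have "?Q \<subseteq> Q" by auto
    ultimately have "?Q = Q"
      by (intro min derivation_core_prime[OF Q(1) g])
    then have "((\<lambda>x. br x g) ^^ 1) a \<in> Q" using a by blast
    then show ?thesis by simp
  qed
  then have "is_poisson_ideal n s t Q"
    using QI by (simp add: is_poisson_ideal_def)
  then have "Q = ?C"
    using poisson_core_greatest[OF I _ Q(3)] Q(2) by blast
  then show ?thesis using Q(1) by simp
qed

section \<open>Locally closed implies primitive implies rational\<close>

lemma primitive_poisson_prime:
  "is_poisson_primitive n s t P \<Longrightarrow> is_poisson_prime n s t P"
  unfolding is_poisson_primitive_def is_poisson_prime_def
  by (auto intro: poisson_core_prime poisson_core_eq(2) maximal_prime prime_ideal)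

text \<open>Some \<open>g\<close> outside \<open>P\<close> lies in all strictly larger Poisson
  primes. The core of a maximal ideal above \<open>P\<close> that omits \<open>g\<close> is a
  Poisson prime above \<open>P\<close> without \<open>g\<close>, hence \<open>P\<close>
  itself.\<close>

lemma locally_closed_imp_primitive:
  assumes P: "is_poisson_prime n s t P" and lc: "locally_closed n s t P"
  shows "is_poisson_primitive n s t P"
proof -
  have Pp: "is_prime_ideal n P" "is_poisson_ideal n s t P"
    using P by (auto simp: is_poisson_prime_def)
  obtain g where g: "g \<in> Apoly n" "g \<notin> P" "\<And>Q. is_poisson_prime n s t Q \<Longrightarrow> P \<subset> Q \<Longrightarrow> g \<in> Q"
  proof (cases "\<exists>Q. is_poisson_prime n s t Q \<and> P \<subset> Q")
    case True
    then obtain Q0 where Q0: "is_poisson_prime n s t Q0" "P \<subset> Q0" by blast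
    from lc obtain g where "g \<notin> P" "g \<in> \<Inter>{Q. is_poisson_prime n s t Q \<and> P \<subset> Q}"
      unfolding locally_closed_def by blast
    with Q0 that show thesis
      using ideal_subset[OF prime_ideal, of n Q0 g] by (auto simp: is_poisson_prime_def)
  next
    case False
    \<comment> \<open>With no larger Poisson prime the condition on \<open>g\<close> is empty, and
      \<open>g = 1\<close> serves.\<close>
    then show thesis using that[of 1] prime_one[OF Pp(1)] by auto
  qed
  obtain M where M: "is_maximal_ideal n M" "P \<subseteq> M" "g \<notin> M"
    using maximal_above_prime[OF Pp(1) g(1,2)] by blast
  have MI: "is_ideal n M" using M(1) by (simp add: is_maximal_ideal_def)
  let ?C = "poisson_core n s t M"
  have "P \<subseteq> ?C" by (rule poisson_core_greatest[OF MI Pp(2) M(2)])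
  moreover have "is_poisson_prime n s t ?C"
    using M(1) by (intro primitive_poisson_prime) (auto simp: is_poisson_primitive_def)
  moreover have "g \<notin> ?C" using poisson_core_subset[OF MI] M(3) by blast
  ultimately have "P = ?C" using g(3) by blast
  then show ?thesis using M(1) by (auto simp: is_poisson_primitive_def)
qed

text \<open>The ideal of denominators of the central element a / b of the fraction field of A / P.\<close>

lemma denominator_ideal_poisson:
  assumes P: "is_poisson_prime n s t P" and ab: "a \<in> Apoly n" "b \<in> Apoly n" "b \<notin> P"
    and central: "\<And>c. c \<in> Apoly n \<Longrightarrow> b * br a c - a * br b c \<in> P"
  shows "is_poisson_ideal n s t {h \<in> Apoly n. \<exists>r\<in>Apoly n. h * a - r * b \<in> P}" (is "is_poisson_ideal n s t ?I")
proof -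
  have Pp: "is_prime_ideal n P" "is_poisson_ideal n s t P" and I: "is_ideal n P"
    using P by (auto simp: is_poisson_prime_def is_poisson_ideal_def)
  show ?thesis
    unfolding is_poisson_ideal_def is_ideal_def
  proof (intro conjI ballI)
    show "0 \<in> ?I" using ideal_zero[OF I] by (auto intro!: bexI[of _ 0])
    fix h assume "h \<in> ?I"
    then obtain r where h: "h \<in> Apoly n" "r \<in> Apoly n" "h * a - r * b \<in> P" by blast
    show "h + k \<in> ?I" if "k \<in> ?I" for k
    proof -
      from that obtain q where k: "k \<in> Apoly n" "q \<in> Apoly n" "k * a - q * b \<in> P" by blast
      have "(h + k) * a - (r + q) * b = (h * a - r * b) + (k * a - q * b)" by (simp add: algebra_simps)
      then have "(h + k) * a - (r + q) * b \<in> P" using ideal_add[OF I h(3) k(3)] by metis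
      then show ?thesis using h k by (auto intro!: bexI[of _ "r + q"])
    qed
    show "x * h \<in> ?I" if "x \<in> Apoly n" for x
    proof -
      have "(x * h) * a - (x * r) * b = x * (h * a - r * b)" by (simp add: algebra_simps)
      then have "(x * h) * a - (x * r) * b \<in> P" using ideal_mult[OF I h(3) that] by metis
      then show ?thesis using h that by (auto intro!: bexI[of _ "x * r"])
    qed
    show "br h g \<in> ?I" if g: "g \<in> Apoly n" for g
    proof -
      have "br (h * a - r * b) g \<in> P" by (rule poisson_br[OF Pp(2) h(3) g])
      then have 1: "b * br (h * a - r * b) g \<in> P" by (rule ideal_mult[OF I _ ab(2)])
      have 2: "h * (b * br a g - a * br b g) \<in> P" by (rule ideal_mult[OF I central[OF g] h(1)])
      have 3: "br b g * (h * a - r * b) \<in> P" by (rule ideal_mult[OF I h(3)]) (simp add: ab g)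
      \<comment> \<open>The Leibniz rule leaves unwanted terms in {a, g} and {b, g}; the two
        corrections remove them. The extra factor \<open>b\<close> makes centrality applicable and
        is cancelled afterwards by primeness.\<close>
      have "b * (br h g * a - br r g * b)
          = b * br (h * a - r * b) g - h * (b * br a g - a * br b g) - br b g * (h * a - r * b)"
        by (simp add: br_diff_left br_mult_left algebra_simps)
      then have "b * (br h g * a - br r g * b) \<in> P"
        using ideal_diff[OF I ideal_diff[OF I 1 2] 3] by metis
      then have "br h g * a - br r g * b \<in> P"
        by (rule prime_cancel[OF Pp(1)]) (simp_all add: h g ab)
      then show ?thesis using h g by (auto intro!: bexI[of _ "br r g"])
    qed
  qed auto
qed

text \<open>The denominators of a central a/b form a Poisson ideal not contained in P, the core of
  \<open>M\<close>; so one of them is nonzero at \<open>M\<close>, and the fraction has a value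
  \<open>k\<close> there. If a/b - k were nonzero, its inverse would be central with all
  denominators vanishing at \<open>M\<close>. These would form a Poisson ideal inside P, although
  the numerator \<open>e'\<close> is among them and lies outside P.\<close>

lemma primitive_imp_rational:
  assumes "is_poisson_primitive n s t P"
  shows "poisson_rational n s t P"
  unfolding poisson_rational_def
proof (intro ballI impI)
  fix a b
  assume ab: "a \<in> Apoly n" "b \<in> Apoly n" "b \<notin> P" and c: "poisson_central_frac n s t P a b"
  have PP: "is_poisson_prime n s t P" by (rule primitive_poisson_prime[OF assms])
  then have Pp: "is_prime_ideal n P" "is_poisson_ideal n s t P" and I: "is_ideal n P"
    by (auto simp: is_poisson_prime_def is_poisson_ideal_def)
  obtain M where M: "is_maximal_ideal n M" "P = poisson_core n s t M"
    using assms by (auto simp: is_poisson_primitive_def)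
  have MI: "is_ideal n M" and Mp: "is_prime_ideal n M"
    using M(1) maximal_prime by (auto simp: is_maximal_ideal_def)
  have PM: "P \<subseteq> M" using M(2) poisson_core_subset[OF MI] by simp
  have central: "b * br a g - a * br b g \<in> P" if "g \<in> Apoly n" for g
  proof -
    have "frac_bracket_num n s t a b g 1 \<in> P"
      by (rule c[unfolded poisson_central_frac_def, rule_format, OF that Apoly_one prime_one[OF Pp(1)]])
    moreover have "frac_bracket_num n s t a b g 1 = b * br a g - a * br b g"
      by (simp add: frac_bracket_num_def algebra_simps)
    ultimately show ?thesis by metis
  qed
  let ?D = "{h \<in> Apoly n. \<exists>r\<in>Apoly n. h * a - r * b \<in> P}"
  have D: "is_poisson_ideal n s t ?D" by (rule denominator_ideal_poisson[OF PP ab central])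
  have "b * a - a * b \<in> P" using ideal_zero[OF I] by (simp add: mult.commute)
  then have "b \<in> ?D" using ab(1,2) by blast
  then have "\<not> ?D \<subseteq> M"
    using poisson_core_greatest[OF MI D] M(2) ab(3) by blast
  then obtain d e where de: "d \<in> Apoly n" "e \<in> Apoly n" "d * a - e * b \<in> P" "d \<notin> M" by blast
  obtain x y where xy: "e - const x \<in> M" "d - const y \<in> M"
    using maximal_residue_const[OF M(1)] de by meson
  have y0: "y \<noteq> 0" using xy(2) de(4) by auto
  \<comment> \<open>The value of the fraction e/d at the point \<open>M\<close>; accordingly
    \<open>e'\<close> vanishes there.\<close>
  define k where "k = x / y"
  define e' where "e' = e - const k * d"
  have e'A: "e' \<in> Apoly n" using de by (simp add: e'_def)
  have "e' = (e - const x) - const k * (d - const y)"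
    using y0 by (simp add: e'_def k_def algebra_simps const_mult[symmetric])
  then have e'M: "e' \<in> M"
    using xy ideal_diff[OF MI] ideal_mult[OF MI] by simp
  have "e' \<in> P"
  proof (rule ccontr)
    assume e'P: "e' \<notin> P"
    have "e' * br d g - d * br e' g \<in> P" if g: "g \<in> Apoly n" for g
    proof -
      have 0: "br (d * a - e * b) g \<in> P" by (rule poisson_br[OF Pp(2) de(3) g])
      have 1: "b * br (d * a - e * b) g \<in> P" by (rule ideal_mult[OF I 0 ab(2)])
      have 2: "d * (b * br a g - a * br b g) \<in> P" by (rule ideal_mult[OF I central[OF g] de(1)])
      have 3: "br b g * (d * a - e * b) \<in> P" by (rule ideal_mult[OF I de(3)]) (simp add: ab g)
      have "b * (a * br d g - b * br e g)
          = b * br (d * a - e * b) g - d * (b * br a g - a * br b g) - br b g * (d * a - e * b)"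
        by (simp add: br_diff_left br_mult_left algebra_simps)
      then have "b * (a * br d g - b * br e g) \<in> P"
        using ideal_diff[OF I ideal_diff[OF I 1 2] 3] by metis
      then have "a * br d g - b * br e g \<in> P"
        by (rule prime_cancel[OF Pp(1)]) (simp_all add: ab de g)
      then have 4: "d * (a * br d g - b * br e g) \<in> P" by (rule ideal_mult[OF I _ de(1)])
      have 5: "br d g * (d * a - e * b) \<in> P" by (rule ideal_mult[OF I de(3)]) (simp add: de g)
      have "b * (e * br d g - d * br e g) = d * (a * br d g - b * br e g) - br d g * (d * a - e * b)"
        by (simp add: algebra_simps)
      then have "b * (e * br d g - d * br e g) \<in> P"
        using ideal_diff[OF I 4 5] by metis
      then have "e * br d g - d * br e g \<in> P"
        by (rule prime_cancel[OF Pp(1)]) (simp_all add: ab de g)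
      moreover have "e' * br d g - d * br e' g = e * br d g - d * br e g"
        unfolding e'_def br_diff_left br_const_mult_left by (simp add: algebra_simps)
      ultimately show ?thesis by metis
    qed
    then have "is_poisson_ideal n s t {h \<in> Apoly n. \<exists>r\<in>Apoly n. h * d - r * e' \<in> P}" (is "is_poisson_ideal n s t ?E")
      by (rule denominator_ideal_poisson[OF PP de(1) e'A e'P])
    \<comment> \<open>At the point \<open>M\<close> the element \<open>e'\<close> vanishes and
      \<open>d\<close> does not, so \<open>d\<close> / \<open>e'\<close> has a pole and each of its
      denominators must vanish.\<close>
    moreover have "?E \<subseteq> M"
    proof
      fix h assume "h \<in> ?E"
      then obtain r where h: "h \<in> Apoly n" "r \<in> Apoly n" "h * d - r * e' \<in> P" by blast
      then have "h * d \<in> M"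
        using PM ideal_add_cancel[OF MI, of "h * d" "r * e'"] ideal_mult[OF MI e'M] by blast
      then show "h \<in> M" using prime_mult[OF Mp h(1) de(1)] de(4) by blast
    qed
    ultimately have "?E \<subseteq> P" using poisson_core_greatest[OF MI] M(2) by simp
    moreover have "e' * d - d * e' \<in> P" using ideal_zero[OF I] by (simp add: mult.commute)
    then have "e' \<in> ?E" using e'A de(1) by blast
    ultimately show False using e'P by blast
  qed
  then have "b * e' \<in> P" by (rule ideal_mult[OF I _ ab(2)])
  moreover have "d * (a - const k * b) = (d * a - e * b) + b * e'"
    by (simp add: e'_def algebra_simps)
  ultimately have "d * (a - const k * b) \<in> P"
    using ideal_add[OF I de(3)] by metis
  moreover have "d \<notin> P" using de(4) PM by blast
  ultimately show "\<exists>k. a - const k * b \<in> P"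
    using prime_mult[OF Pp(1) de(1), of "a - const k * b"] ab by auto
qed

end

section \<open>Poisson primes that are not residually null\<close>

lemma ipow_mult:
  assumes M: "is_ideal n M" and g: "g \<in> ipow n M k"
  shows "x \<in> ipow n M j \<Longrightarrow> x * g \<in> ipow n M (j + k)"
proof (induction j arbitrary: x)
  case 0
  then show ?case using ideal_mult[OF ipow_ideal[OF M] g] by simp
next
  case (Suc j)
  have I: "is_ideal n (ipow n M (Suc j + k))" by (rule ipow_ideal[OF M])
  have "x \<in> iprod M (ipow n M j)" using Suc.prems by simp
  then show ?case
  proof induction
    case iprod_zero
    then show ?case using ideal_zero[OF I] by simp
  next
    case (iprod_step a b c)
    have "a * (b * g) \<in> ipow n M (Suc j + k)"
      using iprodI[OF iprod_step(1) Suc.IH[OF iprod_step(2)]] by simp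
    then have "a * (b * g) + c * g \<in> ipow n M (Suc j + k)"
      by (rule ideal_add[OF I _ iprod_step(4)])
    then show ?case by (simp add: algebra_simps)
  qed
qed

text \<open>Taylor expansion to first order at the point of the maximal ideal M.\<close>

lemma critical_in_square:
  assumes M: "is_maximal_ideal n M" and h: "h \<in> M" and d: "\<And>k. k < n \<Longrightarrow> pd k h \<in> M"
  shows "h \<in> ipow n M 2"
proof -
  have I: "is_ideal n M" "M \<noteq> Apoly n" using M by (auto simp: is_maximal_ideal_def)
  have I2: "is_ideal n (ipow n M 2)" by (rule ipow_ideal[OF I(1)])
  have sq: "a * b \<in> ipow n M 2" if "a \<in> M" "b \<in> M" for a b
    using ipow_mult[OF I(1), of b 1 a 1] that ipow_one[OF I(1)] by (simp add: numeral_2_eq_2)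
  have sub: "ipow n M 2 \<subseteq> M"
    using ipow_Suc_subset[OF I(1), of 1] ipow_one[OF I(1)] by (simp add: numeral_2_eq_2)
  obtain y where y: "\<And>i. i < n \<Longrightarrow> y i \<in> M" "\<And>i. i < n \<Longrightarrow> \<exists>c. y i = var i - const c"
    using maximal_generators[OF M] by metis
  have yA: "y i \<in> Apoly n" if "i < n" for i by (rule ideal_subset[OF I(1) y(1)[OF that]])
  \<comment> \<open>The linear part of the expansion, with the derivatives as coefficients instead
    of their values at the point. The difference lies in the square of \<open>M\<close>, and
    \<open>G\<close> becomes a derivation, which suits the induction over polynomials.\<close>
  define G where "G p = (\<Sum>k<n. pd k p * y k)" for p
  have GM: "G p \<in> M" if "p \<in> Apoly n" for p
    unfolding G_def using that y(1) by (intro ideal_sum[OF I(1)] ideal_mult[OF I(1)]) auto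
  have G_add: "G (a + b) = G a + G b" for a b
    by (simp add: G_def pd_add distrib_right sum.distrib)
  have G_mult: "G (a * b) = a * G b + b * G a" for a b
    unfolding G_def sum_distrib_left sum.distrib[symmetric]
    by (intro sum.cong refl) (simp add: pd_mult algebra_simps)
  have "\<exists>e. p - G p - const e \<in> ipow n M 2" if "p \<in> Apoly n" for p
    using that
  proof (induction p rule: Apoly_induct)
    case (const c)
    then show ?case
      using ideal_zero[OF I2] by (intro exI[of _ c]) (simp add: G_def)
  next
    case (var i)
    then obtain c where c: "y i = var i - const c" using y(2) by blast
    have "G (var i) = y i"
      using var by (simp add: G_def pd_var if_distrib[of "\<lambda>x. x * _"] sum.delta cong: if_cong)
    with c show ?case using ideal_zero[OF I2] by (intro exI[of _ c]) simp
  next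
    case (add a b)
    then obtain e f where "a - G a - const e \<in> ipow n M 2" "b - G b - const f \<in> ipow n M 2" by blast
    then have "(a - G a - const e) + (b - G b - const f) \<in> ipow n M 2" by (rule ideal_add[OF I2])
    then show ?case by (intro exI[of _ "e + f"]) (simp add: G_add const_add algebra_simps)
  next
    case (mult a b)
    then obtain e f where ef: "a - G a - const e \<in> ipow n M 2" "b - G b - const f \<in> ipow n M 2" by blast
    have "(a - const e) \<in> M" "(b - const f) \<in> M"
      using ideal_add[OF I(1) subsetD[OF sub ef(1)] GM[OF mult(1)]]
        ideal_add[OF I(1) subsetD[OF sub ef(2)] GM[OF mult(2)]] by simp_all
    then have 1: "(a - const e) * (b - const f) \<in> ipow n M 2" by (rule sq)
    have 2: "b * (a - G a - const e) \<in> ipow n M 2" by (rule ideal_mult[OF I2 ef(1) mult(2)])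
    have 3: "a * (b - G b - const f) \<in> ipow n M 2" by (rule ideal_mult[OF I2 ef(2) mult(1)])
    have "a * b - G (a * b) - const (e * f)
        = b * (a - G a - const e) + a * (b - G b - const f) - (a - const e) * (b - const f)"
      by (simp add: G_mult const_mult algebra_simps)
    then have "a * b - G (a * b) - const (e * f) \<in> ipow n M 2"
      using ideal_diff[OF I2 ideal_add[OF I2 2 3] 1] by metis
    then show ?case by blast
  qed
  then obtain e where e: "h - G h - const e \<in> ipow n M 2"
    using ideal_subset[OF I(1) h] by blast
  have Gh: "G h \<in> ipow n M 2"
    unfolding G_def using d y(1) by (intro ideal_sum[OF I2] sq) auto
  have "h - (h - G h - const e) - G h \<in> M"
    by (rule ideal_diff[OF I(1) ideal_diff[OF I(1) h subsetD[OF sub e]] subsetD[OF sub Gh]])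
  moreover have "h - (h - G h - const e) - G h = const e" by simp
  ultimately have "e = 0" by (intro const_in_ideal[OF I]) metis
  then show ?thesis
    using ideal_add[OF I2 e Gh] by simp
qed

context jacobian_poisson
begin

text \<open>Along the common zeros of the f i, the row W (i + 2) is proportional to the gradient of f i.\<close>

lemma W_gradient:
  fixes i :: nat and l m :: complex
  assumes i: "i < n - 2" and lm: "(l, m) \<noteq> (0, 0)"
  defines "f \<equiv> const l * s i - const m * t i"
  obtains u where "u \<in> Apoly n" "\<And>j. W (i + 2) j = u * pd j f - f * pd j u"
proof (cases "l = 0")
  case False
  \<comment> \<open>Here f/u = l^2 (s/t) - l m, so u^2 d(f/u) = t^2 d(s/t).\<close>
  let ?u = "const (inverse l) * t i"
  have "W (i + 2) j = const (inverse l) * (const l * (t i * pd j (s i) - s i * pd j (t i)))" for j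
    using False by (simp add: W_def const_inverse_mult)
  also have "\<dots> j = ?u * pd j f - f * pd j ?u" for j
    unfolding f_def pd_diff pd_const_mult by (simp add: algebra_simps)
  finally show thesis using i t_Apoly by (intro that[of ?u]) auto
next
  case True
  then have m: "m \<noteq> 0" using lm by simp
  \<comment> \<open>Here f/u = -m^2 (t/s), so again u^2 d(f/u) = t^2 d(s/t).\<close>
  let ?u = "const (inverse m) * s i"
  have "W (i + 2) j = const (inverse m) * (const m * (t i * pd j (s i) - s i * pd j (t i)))" for j
    using m by (simp add: W_def const_inverse_mult)
  also have "\<dots> j = ?u * pd j f - f * pd j ?u" for j
    unfolding f_def pd_diff pd_const_mult by (simp add: algebra_simps)
  finally show thesis using i s_Apoly by (intro that[of ?u]) auto
qed

text \<open>The fractions f/t = l (s/t) - m and f/s = l - m (t/s) are Casimirs; these are the two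
  identities with denominators cleared.\<close>

lemma pencil_br:
  fixes i :: nat and l m :: complex
  assumes i: "i < n - 2"
  defines "f \<equiv> const l * s i - const m * t i"
  shows "t i * br f g = f * br (t i) g" "s i * br f g = f * br (s i) g"
proof -
  have c: "t i * br (s i) g = s i * br (t i) g" by (rule casimir[OF i])
  have "t i * br f g = const l * (t i * br (s i) g) - const m * (t i * br (t i) g)"
    by (simp add: f_def br_diff_left br_const_mult_left algebra_simps)
  also have "\<dots> = f * br (t i) g" unfolding c by (simp add: f_def algebra_simps)
  finally show "t i * br f g = f * br (t i) g" .
  have "s i * br f g = const l * (s i * br (s i) g) - const m * (s i * br (t i) g)"
    by (simp add: f_def br_diff_left br_const_mult_left algebra_simps)
  also have "\<dots> = f * br (s i) g" unfolding c[symmetric] by (simp add: f_def algebra_simps)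
  finally show "s i * br f g = f * br (s i) g" .
qed

text \<open>The hypothesis makes f/u a Casimir after inverting \<open>u\<close>, so \<open>f\<close>
  generates a Poisson ideal of A[1/u]. The set is the contraction of that ideal to A.\<close>

lemma saturation_poisson:
  assumes f: "f \<in> Apoly n" and u: "u \<in> Apoly n" and br: "\<And>g. u * br f g = f * br u g"
  shows "is_poisson_ideal n s t {h \<in> Apoly n. \<exists>N. \<exists>r\<in>Apoly n. u ^ N * h = f * r}"
    (is "is_poisson_ideal n s t ?F")
  unfolding is_poisson_ideal_def is_ideal_def
proof (intro conjI ballI)
  show "0 \<in> ?F" by (auto intro: bexI[of _ 0])
  fix h assume "h \<in> ?F"
  then obtain N r where h: "h \<in> Apoly n" "r \<in> Apoly n" "u ^ N * h = f * r" by blast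
  show "h + k \<in> ?F" if "k \<in> ?F" for k
  proof -
    from that obtain K q where k: "k \<in> Apoly n" "q \<in> Apoly n" "u ^ K * k = f * q" by blast
    have "u ^ (N + K) * (h + k) = u ^ K * (u ^ N * h) + u ^ N * (u ^ K * k)"
      by (simp add: power_add algebra_simps)
    also have "\<dots> = f * (u ^ K * r + u ^ N * q)"
      unfolding h(3) k(3) by (simp add: algebra_simps)
    finally have "\<exists>N. \<exists>r\<in>Apoly n. u ^ N * (h + k) = f * r"
      using u h(2) k(2) by (intro exI[of _ "N + K"] bexI[of _ "u ^ K * r + u ^ N * q"]) auto
    then show ?thesis using h(1) k(1) by simp
  qed
  show "x * h \<in> ?F" if "x \<in> Apoly n" for x
  proof -
    have "u ^ N * (x * h) = f * (x * r)"
      using h(3) by (metis mult.left_commute)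
    then have "\<exists>N. \<exists>r\<in>Apoly n. u ^ N * (x * h) = f * r"
      using that h(2) Apoly_mult by blast
    then show ?thesis using that h(1) by simp
  qed
  show "br h g \<in> ?F" if g: "g \<in> Apoly n" for g
  proof -
    \<comment> \<open>The factor \<open>u\<close> avoids the exponent \<open>N - 1\<close>, so
      \<open>N = 0\<close> needs no separate case.\<close>
    have pow: "u * br (u ^ N) g = of_nat N * u ^ N * br u g"
      by (induction N) (simp_all add: br_mult_left algebra_simps)
    have "u ^ N * br h g + h * br (u ^ N) g = f * br r g + r * br f g"
      using arg_cong[OF h(3), of "\<lambda>x. br x g"] by (simp add: br_mult_left)
    then have "u * (u ^ N * br h g + h * br (u ^ N) g) = u * (f * br r g + r * br f g)"
      by (simp only:)
    then have "u * (u ^ N * br h g) + h * (u * br (u ^ N) g) = u * (f * br r g) + r * (u * br f g)"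
      by (simp only: distrib_left mult.left_commute)
    then have "u ^ Suc N * br h g + of_nat N * br u g * (u ^ N * h) = f * (u * br r g + r * br u g)"
      unfolding pow br by (simp add: algebra_simps)
    then have "u ^ Suc N * br h g = f * (u * br r g + r * br u g - of_nat N * br u g * r)"
      unfolding h(3) by (simp add: algebra_simps eq_diff_eq)
    moreover have "u * br r g + r * br u g - of_nat N * br u g * r \<in> Apoly n"
      using u g h(2) by simp
    ultimately have "\<exists>N. \<exists>r\<in>Apoly n. u ^ N * br h g = f * r"
      by blast
    then show ?thesis using g h(1) by simp
  qed
qed auto

text \<open>Choose a point M of P at which the bracket of some a, b (vanishing at M) does not vanish. There
  the f i together with a, b are local coordinates, and E h = a {h, b} + b {a, h} acts modulo Q as a
  unit times the Euler derivation of the coordinates a, b. As E maps P into M P, this forces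
  P to lie in Q + M^k for all k.\<close>

lemma poisson_prime_unique_above:
  assumes P: "is_poisson_prime n s t P" and Q: "is_poisson_prime n s t Q" and QP: "Q \<subseteq> P"
    and nn: "\<not> residually_null n s t P"
    and lm: "\<And>i. i < n - 2 \<Longrightarrow> (la i, mu i) \<noteq> (0, 0)"
    and f: "\<And>i. i < n - 2 \<Longrightarrow> const (la i) * s i - const (mu i) * t i \<in> Q"
  shows "P \<subseteq> Q"
proof -
  have Pp: "is_prime_ideal n P" "is_poisson_ideal n s t P" "is_ideal n P"
    and Qp: "is_prime_ideal n Q" "is_poisson_ideal n s t Q" "is_ideal n Q"
    using P Q by (auto simp: is_poisson_prime_def is_poisson_ideal_def)
  obtain a0 b0 where ab0: "a0 \<in> Apoly n" "b0 \<in> Apoly n" "br a0 b0 \<notin> P"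
    using nn by (auto simp: residually_null_def)
  define u where "u = br a0 b0"
  have uA: "u \<in> Apoly n" using ab0 by (simp add: u_def)
  obtain M where M: "is_maximal_ideal n M" "P \<subseteq> M" "u \<notin> M"
    using maximal_above_prime[OF Pp(1) uA] ab0(3) unfolding u_def by blast
  have I: "is_ideal n M" "M \<noteq> Apoly n" using M(1) by (auto simp: is_maximal_ideal_def)
  obtain c d where cd: "a0 - const c \<in> M" "b0 - const d \<in> M"
    using maximal_residue_const[OF M(1)] ab0 by meson
  \<comment> \<open>Subtracting constants makes both functions vanish at the point \<open>M\<close>
    and leaves their bracket unchanged.\<close>
  define a b where "a = a0 - const c" and "b = b0 - const d"
  have ab: "a \<in> M" "b \<in> M" "a \<in> Apoly n" "b \<in> Apoly n" "br a b = u"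
    using cd ab0 by (auto simp: a_def b_def u_def br_diff_left br_diff_right)
  define E where "E h = a * br h b + b * br a h" for h
  have E_add: "E (x + y) = E x + E y" for x y
    by (simp add: E_def br_add_left br_add_right algebra_simps)
  have E_mult: "E (x * y) = x * E y + y * E x" for x y
    by (simp add: E_def br_mult_left br_mult_right algebra_simps)
  have E_Q: "E x \<in> Q" if "x \<in> Q" for x
    unfolding E_def using that ab
    by (intro ideal_add[OF Qp(3)] ideal_mult[OF Qp(3)] poisson_br[OF Qp(2)] poisson_br_right[OF Qp(2)])
  have E_0: "E 0 = 0" using E_add[of 0 0] by simp
  define S where "S k = isum Q (ipow n M k)" for k
  have S: "is_ideal n (S k)" for k
    unfolding S_def by (rule isum_ideal[OF Qp(3) ipow_ideal[OF I(1)]])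
  have Q_S: "x \<in> S k" if "x \<in> Q" for x k
    unfolding S_def by (rule isum_left[OF ipow_ideal[OF I(1)] that])
  have ipow_S: "x \<in> S k" if "x \<in> ipow n M k" for x k
    unfolding S_def by (rule isum_right[OF Qp(3) that])
  have S_mult: "x * g \<in> S (j + k)" if x: "x \<in> S j" and g: "g \<in> ipow n M k" for x g j k
  proof -
    from x obtain q y where "x = q + y" "q \<in> Q" "y \<in> ipow n M j" by (auto simp: S_def isum_def)
    moreover have "g \<in> Apoly n" by (rule ideal_subset[OF ipow_ideal[OF I(1)] g])
    ultimately show ?thesis
      unfolding S_def distrib_right
      using ipow_mult[OF I(1) g] ideal_mult_right[OF Qp(3)] by (auto simp: distrib_right intro: isumI)
  qed
  have M1: "x \<in> ipow n M 1" if "x \<in> M" for x using that ipow_one[OF I(1)] by simp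
  have E_M: "E x - u * x \<in> S 2" if x: "x \<in> M" for x
  proof -
    have xA: "x \<in> Apoly n" by (rule ideal_subset[OF I(1) x])
    define N where "N = W(0 := (\<lambda>j. pd j a), 1 := (\<lambda>j. pd j b))"
    define F where "F i = const (la i) * s i - const (mu i) * t i" for i
    \<comment> \<open>The coefficient of row \<open>i + 2\<close> in Cramer's rule for the gradient
      of \<open>x\<close>; those of rows 0 and 1 are {x, b} and {a, x}.\<close>
    define k where "k i = detn n (N(i + 2 := (\<lambda>j. pd j x)))" for i
    have NA: "N i j \<in> Apoly n" if "i < n" for i j
      using that ab by (auto simp: N_def intro: W_Apoly)
    have kA: "k i \<in> Apoly n" for i
      unfolding k_def using NA xA by (intro detn_Apoly) auto
    have "\<forall>i. \<exists>v. i < n - 2 \<longrightarrow> v \<in> Apoly n \<and> (\<forall>j. W (i + 2) j = v * pd j (F i) - F i * pd j v)"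
    proof
      fix i
      show "\<exists>v. i < n - 2 \<longrightarrow> v \<in> Apoly n \<and> (\<forall>j. W (i + 2) j = v * pd j (F i) - F i * pd j v)"
      proof (cases "i < n - 2")
        case True
        obtain v where "v \<in> Apoly n" "\<And>j. W (i + 2) j = v * pd j (F i) - F i * pd j v"
          using W_gradient[OF True lm[OF True]] unfolding F_def by blast
        then show ?thesis by blast
      qed simp
    qed
    then obtain v where v: "\<And>i. i < n - 2 \<Longrightarrow> v i \<in> Apoly n"
      "\<And>i j. i < n - 2 \<Longrightarrow> W (i + 2) j = v i * pd j (F i) - F i * pd j (v i)"
      by metis
    have FM: "F i \<in> Q" "F i \<in> M" if "i < n - 2" for i
      using f[OF that] QP M(2) by (auto simp: F_def)
    have cramer: "u * pd j x = br x b * pd j a + br a x * pd j b + (\<Sum>i<n - 2. k i * W (i + 2) j)" if j: "j < n" for j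
    proof -
      have n: "n = Suc (Suc (n - 2))" using n3 by simp
      have "u * pd j x = (\<Sum>r<n. detn n (N(r := (\<lambda>j. pd j x))) * N r j)"
        using detn_cramer[OF j, of N "\<lambda>j. pd j x"] by (simp only: N_def br_eq[symmetric] ab(5))
      also have "\<dots> = (\<Sum>r<Suc (Suc (n - 2)). detn n (N(r := (\<lambda>j. pd j x))) * N r j)"
        using n by simp
      also have "\<dots> = detn n (N(0 := (\<lambda>j. pd j x))) * N 0 j + detn n (N(1 := (\<lambda>j. pd j x))) * N 1 j
          + (\<Sum>i<n - 2. k i * N (i + 2) j)"
        by (simp only: sum.lessThan_Suc_shift k_def) (simp add: add.assoc)
      also have "N(0 := (\<lambda>j. pd j x)) = W(0 := (\<lambda>j. pd j x), 1 := (\<lambda>j. pd j b))"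
        by (auto simp: N_def)
      also have "N(1 := (\<lambda>j. pd j x)) = W(0 := (\<lambda>j. pd j a), 1 := (\<lambda>j. pd j x))"
        by (auto simp: N_def)
      finally show ?thesis
        unfolding br_eq[symmetric] by (simp add: N_def)
    qed
    \<comment> \<open>Cramer's rule with functions in place of gradients. The row
      \<open>W (i + 2)\<close> is replaced by \<open>v i * F i\<close>, whose gradient agrees with
      it modulo \<open>M\<close> because \<open>F i\<close> lies in \<open>M\<close>; so
      \<open>x'\<close> and its gradient vanish at the point.\<close>
    define x' where "x' = u * x - br x b * a - br a x * b - (\<Sum>i<n - 2. k i * (v i * F i))"
    have x'2: "x' \<in> ipow n M 2"
    proof (rule critical_in_square[OF M(1)])
      show "x' \<in> M"
        unfolding x'_def using x uA ab xA kA v(1) FM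
        by (intro ideal_diff[OF I(1)] ideal_sum[OF I(1)] ideal_mult[OF I(1)]) auto
      fix j assume j: "j < n"
      have "pd j x' = pd j u * x - pd j (br x b) * a - pd j (br a x) * b
          + (u * pd j x - br x b * pd j a - br a x * pd j b)
          - (\<Sum>i<n - 2. pd j (k i * (v i * F i)))"
        by (simp add: x'_def pd_diff pd_mult[of j u x] pd_mult[of j _ a] pd_mult[of j _ b] pd_sum)
      also have "u * pd j x - br x b * pd j a - br a x * pd j b = (\<Sum>i<n - 2. k i * W (i + 2) j)"
        using cramer[OF j] by simp
      also have "pd j u * x - pd j (br x b) * a - pd j (br a x) * b + (\<Sum>i<n - 2. k i * W (i + 2) j)
            - (\<Sum>i<n - 2. pd j (k i * (v i * F i)))
          = pd j u * x - pd j (br x b) * a - pd j (br a x) * b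
            + (\<Sum>i<n - 2. k i * W (i + 2) j - pd j (k i * (v i * F i)))"
        by (simp add: sum_subtractf)
      \<comment> \<open>The terms with \<open>pd j (F i)\<close> cancel, and all that remains
        carries the factor \<open>F i\<close>.\<close>
      also have "(\<Sum>i<n - 2. k i * W (i + 2) j - pd j (k i * (v i * F i)))
          = (\<Sum>i<n - 2. - (pd j (k i) * v i + (k i + k i) * pd j (v i)) * F i)"
      proof (intro sum.cong refl)
        fix i assume "i \<in> {..<n - 2}"
        then have "W (i + 2) j = v i * pd j (F i) - F i * pd j (v i)" using v(2) by simp
        then show "k i * W (i + 2) j - pd j (k i * (v i * F i))
            = - (pd j (k i) * v i + (k i + k i) * pd j (v i)) * F i"
          by (simp only: pd_mult) (simp add: algebra_simps)
      qed
      also have "pd j u * x - pd j (br x b) * a - pd j (br a x) * b + \<dots> \<in> M"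
      proof (rule ideal_add[OF I(1)])
        show "pd j u * x - pd j (br x b) * a - pd j (br a x) * b \<in> M"
          by (rule ideal_diff[OF I(1) ideal_diff[OF I(1) ideal_mult[OF I(1) x] ideal_mult[OF I(1) ab(1)]]
              ideal_mult[OF I(1) ab(2)]]) (simp_all add: uA xA ab(3,4))
        show "(\<Sum>i<n - 2. - (pd j (k i) * v i + (k i + k i) * pd j (v i)) * F i) \<in> M"
        proof (rule ideal_sum[OF I(1)], rule ideal_mult[OF I(1)])
          fix i assume "i \<in> {..<n - 2}"
          then have i: "i < n - 2" by simp
          show "F i \<in> M" by (rule FM(2)[OF i])
          show "- (pd j (k i) * v i + (k i + k i) * pd j (v i)) \<in> Apoly n"
            by (intro Apoly_uminus Apoly_add Apoly_mult Apoly_pd kA v(1)[OF i])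
        qed
      qed
      finally show "pd j x' \<in> M" .
    qed
    have "(\<Sum>i<n - 2. k i * (v i * F i)) \<in> Q"
      using kA v(1) FM(1) by (intro ideal_sum[OF Qp(3)] ideal_mult[OF Qp(3)]) auto
    then have "- (x' + (\<Sum>i<n - 2. k i * (v i * F i))) \<in> S 2"
      by (intro ideal_uminus[OF S] ideal_add[OF S] ipow_S[OF x'2] Q_S)
    moreover have "E x - u * x = - (x' + (\<Sum>i<n - 2. k i * (v i * F i)))"
      by (simp add: x'_def E_def algebra_simps)
    ultimately show ?thesis by (simp only:)
  qed
  \<comment> \<open>Euler's identity: \<open>E\<close> is a derivation that acts on \<open>M\<close>
    as multiplication by \<open>u\<close> modulo \<open>S 2\<close>, so in a product of
    \<open>k\<close> elements of \<open>M\<close> each factor contributes one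
    \<open>u\<close>.\<close>
  have E_pow: "E x - of_nat k * u * x \<in> S (Suc k)" if "x \<in> ipow n M k" for x k
    using that
  proof (induction k arbitrary: x)
    case 0
    then have "E x \<in> M"
      unfolding E_def using ab by (intro ideal_add[OF I(1)] ideal_mult_right[OF I(1)]) auto
    then show ?case using ipow_S[OF M1] by simp
  next
    case (Suc k)
    have "x \<in> iprod M (ipow n M k)" using Suc.prems by simp
    then show ?case
    proof induction
      case iprod_zero
      then show ?case using ideal_zero[OF S] by (simp add: E_0)
    next
      case (iprod_step m g c)
      have 1: "(E m - u * m) * g \<in> S (Suc (Suc k))"
        using S_mult[OF E_M[OF iprod_step(1)] iprod_step(2)] by simp
      have 2: "(E g - of_nat k * u * g) * m \<in> S (Suc (Suc k))"
        using S_mult[OF Suc.IH[OF iprod_step(2)] M1[OF iprod_step(1)]] by simp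
      have "E (m * g + c) - of_nat (Suc k) * u * (m * g + c)
          = ((E m - u * m) * g + (E g - of_nat k * u * g) * m) + (E c - of_nat (Suc k) * u * c)"
        by (simp add: E_add E_mult algebra_simps)
      then show ?case
        using ideal_add[OF S ideal_add[OF S 1 2] iprod_step(4)] by (simp only:)
    qed
  qed
  obtain e where e: "u - const e \<in> M"
    using maximal_residue_const[OF M(1) uA] by blast
  have e0: "e \<noteq> 0" using e M(3) by auto
  have step: "x \<in> S (Suc k)" if sub: "P \<subseteq> S k" and k: "k \<noteq> 0" and x: "x \<in> P" for x k
  proof -
    obtain q m where qm: "x = q + m" "q \<in> Q" "m \<in> ipow n M k"
      using sub x by (auto simp: S_def isum_def)
    have xA: "x \<in> Apoly n" by (rule ideal_subset[OF Pp(3) x])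
    have br: "br x b \<in> S k" "br a x \<in> S k"
      using sub poisson_br[OF Pp(2) x] poisson_br_right[OF Pp(2) x] ab by auto
    \<comment> \<open>For \<open>x\<close> in \<open>P\<close> the brackets lie in \<open>P\<close>
      again, so \<open>E x\<close> gains one order. Euler's identity makes its part of order
      \<open>k\<close> equal to \<open>k * u * m\<close>; since \<open>u\<close> is congruent to
      \<open>const e\<close> with \<open>e \<noteq> 0\<close>, also \<open>m\<close> gains one
      order.\<close>
    have "br x b * a + br a x * b \<in> S (Suc k)"
      using S_mult[OF br(1) M1[OF ab(1)]] S_mult[OF br(2) M1[OF ab(2)]] by (simp add: ideal_add[OF S])
    then have "E x \<in> S (Suc k)"
      by (simp add: E_def mult.commute)
    then have "E x - E q - (E m - of_nat k * u * m) \<in> S (Suc k)"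
      by (rule ideal_diff[OF S ideal_diff[OF S _ Q_S[OF E_Q[OF qm(2)]]] E_pow[OF qm(3)]])
    then have 1: "of_nat k * u * m \<in> S (Suc k)"
      by (simp add: qm(1) E_add)
    have "(u - const e) * m \<in> ipow n M (Suc k)"
      using iprodI[OF e qm(3)] by simp
    then have 2: "of_nat k * ((u - const e) * m) \<in> S (Suc k)"
      by (intro ideal_mult[OF S] ipow_S) auto
    have "const (of_nat k * e) * m = of_nat k * u * m - of_nat k * ((u - const e) * m)"
      by (simp add: const_mult const_of_nat algebra_simps)
    then have "const (of_nat k * e) * m \<in> S (Suc k)"
      using ideal_diff[OF S 1 2] by (simp only:)
    then have "m \<in> S (Suc k)"
      by (rule ideal_const_mult_cancel[OF S, rotated]) (use k e0 in simp)
    then show ?thesis unfolding qm(1) by (intro ideal_add[OF S Q_S[OF qm(2)]])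
  qed
  \<comment> \<open>The step divides by \<open>k\<close>, so the induction has to start at order 1,
    where \<open>P \<subseteq> M\<close> suffices.\<close>
  have P1: "P \<subseteq> S 1" using M(2) ipow_S[OF M1] by blast
  have "P \<subseteq> S (Suc k)" for k
    by (induction k) (use P1 step in auto)
  moreover have "P \<subseteq> S 0"
    using ideal_subset[OF Pp(3)] by (auto intro: ipow_S)
  ultimately have PS: "P \<subseteq> S k" for k by (cases k) auto
  show "P \<subseteq> Q"
  proof
    fix h assume h: "h \<in> P"
    have hA: "h \<in> Apoly n" by (rule ideal_subset[OF Pp(3) h])
    obtain m where m: "m \<in> M" "h - m * h \<in> Q"
      using krull_intersection[OF M(1) Qp(3) hA] PS h unfolding S_def by blast
    have mA: "m \<in> Apoly n" by (rule ideal_subset[OF I(1) m(1)])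
    have "(1 - m) * h \<in> Q" using m(2) by (simp add: algebra_simps)
    moreover have "1 - m \<notin> Q"
    proof
      assume "1 - m \<in> Q"
      then have "(1 - m) + m \<in> M" using QP M(2) m(1) by (intro ideal_add[OF I(1)]) auto
      then show False using I ideal_eq_Apoly by simp
    qed
    ultimately show "h \<in> Q"
      using prime_cancel[OF Qp(1), of "1 - m" h] mA hA by simp
  qed
qed

section \<open>Primes over the ideals generated by the f i\<close>

lemma gen_ideal_subset:
  assumes P: "is_ideal n P"
  shows "gen_ideal n k f \<subseteq> P \<longleftrightarrow> (\<forall>i<k. f i \<in> P)"
proof
  show "gen_ideal n k f \<subseteq> P" if "\<forall>i<k. f i \<in> P"
    using that by (auto simp: gen_ideal_def intro!: ideal_sum[OF P] ideal_mult[OF P])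
  show "\<forall>i<k. f i \<in> P" if sub: "gen_ideal n k f \<subseteq> P"
  proof (intro allI impI)
    fix i assume i: "i < k"
    have "f i = (\<Sum>j<k. (if j = i then 1 else 0) * f j)"
      using i by (simp add: if_distrib[of "\<lambda>x. x * _"] sum.delta cong: if_cong)
    then have "f i \<in> gen_ideal n k f"
      unfolding gen_ideal_def by (auto intro!: exI[of _ "\<lambda>j. if j = i then 1 else 0"])
    then show "f i \<in> P" using sub by blast
  qed
qed

text \<open>A competing prime \<open>Q\<close> need not be Poisson. Its core is, and it still
  contains each f i, because a saturation of the ideal of f i is a Poisson ideal inside
  \<open>Q\<close>.\<close>

lemma minimal_over_pencil:
  assumes P: "is_poisson_prime n s t P" and nn: "\<not> residually_null n s t P"
    and lm: "\<And>i. i < n - 2 \<Longrightarrow> (la i, mu i) \<noteq> (0, 0)"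
    and f: "\<And>i. i < n - 2 \<Longrightarrow> const (la i) * s i - const (mu i) * t i \<in> P"
  shows "is_minimal_prime_over n (gen_ideal n (n - 2) (\<lambda>i. const (la i) * s i - const (mu i) * t i)) P"
  unfolding is_minimal_prime_over_def
proof (intro conjI allI impI)
  have Pp: "is_prime_ideal n P" "is_ideal n P"
    using P by (auto simp: is_poisson_prime_def is_poisson_ideal_def)
  show "is_prime_ideal n P" by (rule Pp(1))
  show "gen_ideal n (n - 2) (\<lambda>i. const (la i) * s i - const (mu i) * t i) \<subseteq> P"
    using f by (simp add: gen_ideal_subset[OF Pp(2)])
  fix Q assume "is_prime_ideal n Q \<and> gen_ideal n (n - 2) (\<lambda>i. const (la i) * s i - const (mu i) * t i) \<subseteq> Q \<and> Q \<subseteq> P"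
  then have Q: "is_prime_ideal n Q" "is_ideal n Q" "Q \<subseteq> P"
    "\<And>i. i < n - 2 \<Longrightarrow> const (la i) * s i - const (mu i) * t i \<in> Q"
    using gen_ideal_subset[of Q] by (auto dest: prime_ideal)
  let ?C = "poisson_core n s t Q"
  have C: "is_poisson_prime n s t ?C"
    using poisson_core_prime[OF Q(1)] poisson_core_eq(2)[OF Q(2)] by (simp add: is_poisson_prime_def)
  have "P \<subseteq> ?C"
  proof (rule poisson_prime_unique_above[OF P C _ nn lm])
    show "?C \<subseteq> P" using poisson_core_subset[OF Q(2)] Q(3) by blast
    fix i assume i: "i < n - 2"
    let ?f = "const (la i) * s i - const (mu i) * t i"
    \<comment> \<open>If \<open>s i\<close> and \<open>t i\<close> were both in \<open>Q\<close>,
      row \<open>i + 2\<close> would lie in \<open>P\<close> and all brackets with it. So one of the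
      two can serve as the denominator \<open>u\<close>.\<close>
    have "\<exists>u\<in>Apoly n. u \<notin> Q \<and> (\<forall>g. u * br ?f g = ?f * br u g)"
    proof (cases "t i \<in> Q")
      case False
      then show ?thesis using t_Apoly[OF i] pencil_br(1)[OF i] by blast
    next
      case True
      have "s i \<notin> Q"
      proof
        assume "s i \<in> Q"
        with True Q(3) have st: "s i \<in> P" "t i \<in> P" by auto
        have "br a b \<in> P" if ab: "a \<in> Apoly n" "b \<in> Apoly n" for a b
        proof (rule br_member_if_row_member[OF Pp(2) _ _ _ ab])
          show "2 \<le> i + 2" "i + 2 < n" using i by auto
          show "W (i + 2) j \<in> P" for j
            using st s_Apoly[OF i] t_Apoly[OF i]
            by (auto simp: W_def intro!: ideal_diff[OF Pp(2)] ideal_mult_right[OF Pp(2)])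
        qed
        then show False using nn by (simp add: residually_null_def)
      qed
      then show ?thesis using s_Apoly[OF i] pencil_br(2)[OF i] by blast
    qed
    then obtain u where u: "u \<in> Apoly n" "u \<notin> Q" "\<And>g. u * br ?f g = ?f * br u g" by blast
    have fA: "?f \<in> Apoly n" using s_Apoly[OF i] t_Apoly[OF i] by simp
    let ?F = "{h \<in> Apoly n. \<exists>N. \<exists>r\<in>Apoly n. u ^ N * h = ?f * r}"
    have "?F \<subseteq> Q"
    proof
      fix h assume "h \<in> ?F"
      then obtain N r where h: "h \<in> Apoly n" "r \<in> Apoly n" "u ^ N * h = ?f * r" by blast
      then have "u ^ N * h \<in> Q" using ideal_mult_right[OF Q(2) Q(4)[OF i]] by metis
      moreover have "u ^ N \<notin> Q" using prime_power[OF Q(1) u(1)] u(2) by blast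
      ultimately show "h \<in> Q"
        using prime_cancel[OF Q(1), of "u ^ N" h] u(1) h(1) by simp
    qed
    then have "?F \<subseteq> ?C"
      by (rule poisson_core_greatest[OF Q(2) saturation_poisson[OF fA u(1) u(3)]])
    moreover have "?f \<in> ?F"
      using fA by (auto intro!: exI[of _ 0] bexI[of _ 1])
    ultimately show "?f \<in> ?C" by blast
  qed
  then show "Q = P" using poisson_core_subset[OF Q(2)] Q(3) by blast
qed

text \<open>A single bracket outside \<open>P\<close> lies in every strictly larger Poisson prime: a
  larger one omitting it would also be minimal over the ideal of the f i, although \<open>P\<close>
  lies between.\<close>

lemma minimal_over_pencil_imp_locally_closed:
  assumes P: "is_poisson_prime n s t P" and nn: "\<not> residually_null n s t P"
    and lm: "\<And>i. i < n - 2 \<Longrightarrow> (la i, mu i) \<noteq> (0, 0)"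
    and f: "\<And>i. i < n - 2 \<Longrightarrow> const (la i) * s i - const (mu i) * t i \<in> P"
  shows "locally_closed n s t P"
proof -
  obtain a b where ab: "a \<in> Apoly n" "b \<in> Apoly n" "br a b \<notin> P"
    using nn by (auto simp: residually_null_def)
  have "br a b \<in> Q" if Q: "is_poisson_prime n s t Q" "P \<subset> Q" for Q
  proof (rule ccontr)
    assume "br a b \<notin> Q"
    then have nnQ: "\<not> residually_null n s t Q" using ab by (auto simp: residually_null_def)
    have Pp: "is_prime_ideal n P" "is_ideal n P"
      using P by (auto simp: is_poisson_prime_def is_poisson_ideal_def)
    have "is_minimal_prime_over n (gen_ideal n (n - 2) (\<lambda>i. const (la i) * s i - const (mu i) * t i)) Q"
      using f Q(2) by (intro minimal_over_pencil[OF Q(1) nnQ lm]) auto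
    moreover have "gen_ideal n (n - 2) (\<lambda>i. const (la i) * s i - const (mu i) * t i) \<subseteq> P"
      using f by (simp add: gen_ideal_subset[OF Pp(2)])
    ultimately have "P = Q"
      using Pp(1) Q(2) unfolding is_minimal_prime_over_def by blast
    then show False using Q(2) by simp
  qed
  then show ?thesis
    using ab(3) by (auto simp: locally_closed_def)
qed

section \<open>Consequences of rationality\<close>

lemma rational_contains_pencil:
  assumes P: "is_poisson_prime n s t P" and rat: "poisson_rational n s t P"
  obtains la mu where "\<And>i. i < n - 2 \<Longrightarrow> (la i, mu i) \<noteq> (0, 0)"
    "\<And>i. i < n - 2 \<Longrightarrow> const (la i) * s i - const (mu i) * t i \<in> P"
proof -
  have Pp: "is_ideal n P"
    using P by (auto simp: is_poisson_prime_def is_poisson_ideal_def)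
  have "\<exists>l m. (l, m) \<noteq> (0, 0) \<and> const l * s i - const m * t i \<in> P" if i: "i < n - 2" for i
  proof (cases "t i \<in> P")
    case True
    \<comment> \<open>The pair (0, -1) turns f i into \<open>t i\<close> itself.\<close>
    then have "const 0 * s i - const (- 1) * t i \<in> P" by (simp add: const_uminus)
    then show ?thesis by (intro exI[of _ 0] exI[of _ "- 1"]) simp
  next
    case False
    have "frac_bracket_num n s t (s i) (t i) c d = 0" for c d
    proof -
      have "frac_bracket_num n s t (s i) (t i) c d
          = (t i * br (s i) c - s i * br (t i) c) * d - (t i * br (s i) d - s i * br (t i) d) * c"
        by (simp add: frac_bracket_num_def algebra_simps)
      then show ?thesis by (simp add: casimir[OF i])
    qed
    then have "poisson_central_frac n s t P (s i) (t i)"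
      using ideal_zero[OF Pp] by (simp add: poisson_central_frac_def)
    then obtain k where "s i - const k * t i \<in> P"
      using rat s_Apoly[OF i] t_Apoly[OF i] False unfolding poisson_rational_def by blast
    then have "const 1 * s i - const k * t i \<in> P" by simp
    then show ?thesis by (intro exI[of _ 1] exI[of _ k]) simp
  qed
  then obtain la mu where "\<And>i. i < n - 2 \<Longrightarrow> (la i, mu i) \<noteq> (0, 0) \<and> const (la i) * s i - const (mu i) * t i \<in> P"
    by metis
  then show thesis by (intro that[of la mu]) auto
qed

text \<open>With zero bracket on A/P every element is central, so rationality leaves only constants
  in A/P.\<close>

lemma rational_null_imp_maximal:
  assumes P: "is_poisson_prime n s t P" and rat: "poisson_rational n s t P"
    and null: "residually_null n s t P"
  shows "is_maximal_ideal n P"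
proof -
  have Pp: "is_prime_ideal n P" "is_ideal n P" "P \<noteq> Apoly n"
    using P by (auto simp: is_poisson_prime_def is_poisson_ideal_def is_prime_ideal_def)
  show ?thesis
  proof (rule maximal_if_residue_const[OF Pp(2,3)])
    fix a assume a: "a \<in> Apoly n"
    have "poisson_central_frac n s t P a 1"
      unfolding poisson_central_frac_def frac_bracket_num_def
    proof (intro ballI impI)
      fix c d assume "c \<in> Apoly n" "d \<in> Apoly n"
      moreover have "br a c \<in> P" "br a d \<in> P"
        using null a calculation by (auto simp: residually_null_def)
      ultimately show "br a c * 1 * d - br a d * 1 * c - br 1 c * a * d + br 1 d * a * c \<in> P"
        by (simp add: ideal_diff[OF Pp(2)] ideal_mult_right[OF Pp(2)])
    qed
    then have "\<exists>k. a - const k * 1 \<in> P"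
      by (rule rat[unfolded poisson_rational_def, rule_format, OF a Apoly_one prime_one[OF Pp(1)]])
    then show "\<exists>k. a - const k \<in> P" by simp
  qed
qed

lemma rational_imp_locally_closed:
  assumes P: "is_poisson_prime n s t P" and rat: "poisson_rational n s t P"
  shows "locally_closed n s t P"
proof (cases "residually_null n s t P")
  case True
  have "is_maximal_ideal n P" by (rule rational_null_imp_maximal[OF P rat True])
  \<comment> \<open>Nothing lies strictly above \<open>P\<close>, and the intersection of the empty
    family is \<open>UNIV\<close>.\<close>
  then have "{Q. is_poisson_prime n s t Q \<and> P \<subset> Q} = {}"
    by (auto simp: is_maximal_ideal_def is_poisson_prime_def is_prime_ideal_def)
  moreover have "P \<noteq> UNIV"
    using P prime_one by (auto simp: is_poisson_prime_def)
  ultimately show ?thesis unfolding locally_closed_def by auto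
next
  case False
  obtain la mu where "\<And>i. i < n - 2 \<Longrightarrow> (la i, mu i) \<noteq> (0, 0)"
    "\<And>i. i < n - 2 \<Longrightarrow> const (la i) * s i - const (mu i) * t i \<in> P"
    by (rule rational_contains_pencil[OF P rat]) blast
  then show ?thesis
    by (rule minimal_over_pencil_imp_locally_closed[OF P False])
qed

end

theorem theorem3p4:
  fixes n :: nat and s t :: "nat \<Rightarrow> mpoly"
  assumes "n \<ge> 3"
    and "\<forall>i<n-2. s i \<in> Apoly n \<and> t i \<in> Apoly n"
    and "\<forall>i<n-2. t i \<noteq> 0"
    and "\<forall>i<n-2. coprimeA n (s i) (t i)"
    and "alg_indep (n-2) s t"
  shows "(\<forall>P. is_poisson_primitive n s t P \<longleftrightarrow>
            is_poisson_maximal n s t P \<or>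
            (is_proper_poisson_ideal n s t P \<and>
             (\<exists>la mu :: nat \<Rightarrow> complex. (\<forall>i<n-2. (la i, mu i) \<noteq> (0, 0)) \<and>
                gen_ideal n (n-2) (\<lambda>i. const (la i) * s i - const (mu i) * t i) \<noteq> Apoly n \<and>
                is_minimal_prime_over n
                  (gen_ideal n (n-2) (\<lambda>i. const (la i) * s i - const (mu i) * t i)) P)))
       \<and> (\<forall>P. is_poisson_prime n s t P \<longrightarrow>
            (locally_closed n s t P \<longleftrightarrow> is_poisson_primitive n s t P) \<and>
            (is_poisson_primitive n s t P \<longleftrightarrow> poisson_rational n s t P))"
proof -
  interpret jacobian_poisson n s t
    using assms(1,2) by unfold_locales auto
  have fwd: "is_poisson_maximal n s t P \<or>
      (is_proper_poisson_ideal n s t P \<and>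
       (\<exists>la mu. (\<forall>i<n-2. (la i, mu i) \<noteq> (0, 0)) \<and>
          gen_ideal n (n-2) (\<lambda>i. const (la i) * s i - const (mu i) * t i) \<noteq> Apoly n \<and>
          is_minimal_prime_over n (gen_ideal n (n-2) (\<lambda>i. const (la i) * s i - const (mu i) * t i)) P))"
    if prim: "is_poisson_primitive n s t P" for P
  proof (cases "residually_null n s t P")
    case True
    have P: "is_poisson_prime n s t P" by (rule primitive_poisson_prime[OF prim])
    then show ?thesis
      using rational_null_imp_maximal[OF P primitive_imp_rational[OF prim] True]
      by (simp add: is_poisson_maximal_def is_poisson_prime_def)
  next
    case False
    have P: "is_poisson_prime n s t P" by (rule primitive_poisson_prime[OF prim])
    then have Pp: "is_poisson_ideal n s t P" "is_ideal n P" "P \<noteq> Apoly n"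
      by (auto simp: is_poisson_prime_def is_prime_ideal_def)
    obtain la mu where lm: "\<And>i. i < n - 2 \<Longrightarrow> (la i, mu i) \<noteq> (0, 0)"
      "\<And>i. i < n - 2 \<Longrightarrow> const (la i) * s i - const (mu i) * t i \<in> P"
      by (rule rational_contains_pencil[OF P primitive_imp_rational[OF prim]]) blast
    let ?J = "gen_ideal n (n - 2) (\<lambda>i. const (la i) * s i - const (mu i) * t i)"
    have "?J \<subseteq> P" using lm(2) by (simp add: gen_ideal_subset[OF Pp(2)])
    then have "?J \<noteq> Apoly n" using Pp(3) ideal_subset[OF Pp(2)] by blast
    moreover have "is_minimal_prime_over n ?J P"
      by (rule minimal_over_pencil[OF P False lm])
    ultimately show ?thesis
      using lm(1) Pp(1) False unfolding is_proper_poisson_ideal_def by blast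
  qed
  \<comment> \<open>A Poisson maximal ideal is its own Poisson core.\<close>
  have bwd_maximal: "is_poisson_primitive n s t P" if "is_poisson_maximal n s t P" for P
    using that poisson_core_id unfolding is_poisson_maximal_def is_poisson_primitive_def by metis
  have bwd_proper: "is_poisson_primitive n s t P"
    if proper: "is_proper_poisson_ideal n s t P"
      and lm: "\<forall>i<n-2. (la i, mu i) \<noteq> (0, 0)"
      and min: "is_minimal_prime_over n (gen_ideal n (n-2) (\<lambda>i. const (la i) * s i - const (mu i) * t i)) P"
    for P la mu
  proof -
    have Pp: "is_poisson_prime n s t P" "is_ideal n P" "\<not> residually_null n s t P"
      using proper min
      by (auto simp: is_proper_poisson_ideal_def is_poisson_prime_def is_poisson_ideal_def is_minimal_prime_over_def)
    have "gen_ideal n (n - 2) (\<lambda>i. const (la i) * s i - const (mu i) * t i) \<subseteq> P"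
      using min by (simp add: is_minimal_prime_over_def)
    then have "const (la i) * s i - const (mu i) * t i \<in> P" if "i < n - 2" for i
      using that by (simp add: gen_ideal_subset[OF Pp(2)])
    then have "locally_closed n s t P"
      using lm by (intro minimal_over_pencil_imp_locally_closed[OF Pp(1,3)]) auto
    then show ?thesis by (rule locally_closed_imp_primitive[OF Pp(1)])
  qed
  show ?thesis
  proof (intro conjI allI impI iffI)
    show "is_poisson_primitive n s t P"
      if "is_poisson_maximal n s t P \<or>
        (is_proper_poisson_ideal n s t P \<and>
         (\<exists>la mu. (\<forall>i<n-2. (la i, mu i) \<noteq> (0, 0)) \<and>
            gen_ideal n (n-2) (\<lambda>i. const (la i) * s i - const (mu i) * t i) \<noteq> Apoly n \<and>
            is_minimal_prime_over n (gen_ideal n (n-2) (\<lambda>i. const (la i) * s i - const (mu i) * t i)) P))" for P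
      using that by (elim disjE conjE exE) (erule bwd_maximal, rule bwd_proper)
  qed (erule fwd, (simp_all add: locally_closed_imp_primitive primitive_imp_rational rational_imp_locally_closed))
qed

end
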